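(* Let $(W,I)$ be of type $A_n$, and let $J_1=\{a,a+1,\dots,n-b\}$ and $J_2=\{a',a'+1,\dots,n-b'\}$ be nonempty proper connected subsets of $I=\{1,\dots,n\}$, where $a,a'\ge 1$ and $b,b'\ge 0$. Then $$J_1\star_I J_2=\{a+a'-1,\,a+a',\,\dots,\,n-b-b'\}.$$
   Context: $(W,I)$ is a finite Coxeter group with simple reflections $s_i$ ($i\in I$). The monoid operation $\ast$ on $W$ is determined by $T'_xT'_y=T'_{x\ast y}$ in the $0$-Hecke algebra, where $T'_{s_i}$ satisfy $T'^2_{s_i}=T'_{s_i}$ and the braid relations, and $T'_w=T'_{s_{i_1}}\cdots T'_{s_{i_k}}$ for any reduced expression $w=s_{i_1}\cdots s_{i_k}$; equivalently $s_i\ast w$ is the Bruhat-larger of $w$ and $s_iw$. For $J\subset I$, $w_0^J$ is the longest element of $W_J=\langle s_j: j\in J\rangle$. For $J_1,J_2\subset I$, $J_1\star_I J_2$ is the unique subset $K\subset I$ with $(w_0^{J_1}w_0^I)\ast(w_0^{J_2}w_0^I)=w_0^{K}w_0^I$ (such a $K$ always exists). Connected means connected in the Coxeter graph. Type $A_n$: Bourbaki labeling, $I=\{1,\dots,n\}$ with Coxeter graph the path $1-2-\cdots-n$ with simple edges. A list $\{p,\dots,q\}$ with $p>q$ denotes the empty set. *)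

theory Defs
  imports "HOL-Algebra.QuotRing" "HOL-Algebra.Generated_Groups" "HOL-Library.Poly_Mapping"
begin

section \<open>Coxeter systems\<close>

fun alternating :: "nat \<Rightarrow> 'i \<Rightarrow> 'i \<Rightarrow> 'i list" where
  "alternating 0 i j = []"
| "alternating (Suc k) i j = i # alternating k j i"

text \<open>An entry \<open>m i j = 0\<close> encodes \<open>m i j = \<infinity>\<close>: the corresponding relations below are then void.\<close>

definition coxeter_matrix :: "'i set \<Rightarrow> ('i \<Rightarrow> 'i \<Rightarrow> nat) \<Rightarrow> bool" where
  "coxeter_matrix I m \<longleftrightarrow> finite I \<and>
     (\<forall>i\<in>I. \<forall>j\<in>I. m i j = m j i \<and> (m i j = 1 \<longleftrightarrow> i = j))"

text \<open>Congruence on words over \<open>I\<close> generated by \<open>(i j)\<^bsup>m i j\<^esup> = 1\<close>. As \<open>m i i = 1\<close>, every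
  letter is its own inverse, so the quotient of the free monoid is the group with this presentation.\<close>

inductive coxeter_cong :: "'i set \<Rightarrow> ('i \<Rightarrow> 'i \<Rightarrow> nat) \<Rightarrow> 'i list \<Rightarrow> 'i list \<Rightarrow> bool"
  for I :: "'i set" and m :: "'i \<Rightarrow> 'i \<Rightarrow> nat" where
  rel: "\<lbrakk>i \<in> I; j \<in> I\<rbrakk> \<Longrightarrow> coxeter_cong I m (concat (replicate (m i j) [i, j])) []"
| refl: "u \<in> lists I \<Longrightarrow> coxeter_cong I m u u"
| sym: "coxeter_cong I m u v \<Longrightarrow> coxeter_cong I m v u"
| trans: "\<lbrakk>coxeter_cong I m u v; coxeter_cong I m v w\<rbrakk> \<Longrightarrow> coxeter_cong I m u w"
| ctxt: "\<lbrakk>coxeter_cong I m u v; x \<in> lists I; y \<in> lists I\<rbrakk> \<Longrightarrow> coxeter_cong I m (x @ u @ y) (x @ v @ y)"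

definition word_prod :: "('w, 'x) monoid_scheme \<Rightarrow> ('i \<Rightarrow> 'w) \<Rightarrow> 'i list \<Rightarrow> 'w" where
  "word_prod W s u = foldr (\<lambda>i x. s i \<otimes>\<^bsub>W\<^esub> x) u \<one>\<^bsub>W\<^esub>"

text \<open>The last two conditions say that \<open>i \<mapsto> s i\<close> induces an isomorphism from the group presented
  by \<open>m\<close> onto \<open>W\<close>.\<close>

definition coxeter_system ::
  "('w, 'x) monoid_scheme \<Rightarrow> 'i set \<Rightarrow> ('i \<Rightarrow> 'i \<Rightarrow> nat) \<Rightarrow> ('i \<Rightarrow> 'w) \<Rightarrow> bool" where
  "coxeter_system W I m s \<longleftrightarrow> group W \<and> coxeter_matrix I m \<and> s \<in> I \<rightarrow> carrier W \<and>
     generate W (s ` I) = carrier W \<and>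
     (\<forall>u\<in>lists I. \<forall>v\<in>lists I. word_prod W s u = word_prod W s v \<longleftrightarrow> coxeter_cong I m u v)"

definition cox_length :: "('w, 'x) monoid_scheme \<Rightarrow> 'i set \<Rightarrow> ('i \<Rightarrow> 'w) \<Rightarrow> 'w \<Rightarrow> nat" where
  "cox_length W I s w = (LEAST k. \<exists>u\<in>lists I. length u = k \<and> word_prod W s u = w)"

definition reduced_word :: "('w, 'x) monoid_scheme \<Rightarrow> 'i set \<Rightarrow> ('i \<Rightarrow> 'w) \<Rightarrow> 'w \<Rightarrow> 'i list \<Rightarrow> bool" where
  "reduced_word W I s w u \<longleftrightarrow> u \<in> lists I \<and> word_prod W s u = w \<and> length u = cox_length W I s w"

definition parabolic :: "('w, 'x) monoid_scheme \<Rightarrow> ('i \<Rightarrow> 'w) \<Rightarrow> 'i set \<Rightarrow> 'w set" where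
  "parabolic W s J = generate W (s ` J)"

definition longest :: "('w, 'x) monoid_scheme \<Rightarrow> 'i set \<Rightarrow> ('i \<Rightarrow> 'w) \<Rightarrow> 'i set \<Rightarrow> 'w" where
  "longest W I s J = (THE w. w \<in> parabolic W s J \<and>
     (\<forall>v\<in>parabolic W s J. cox_length W I s v \<le> cox_length W I s w))"

definition cox_connected :: "('i \<Rightarrow> 'i \<Rightarrow> nat) \<Rightarrow> 'i set \<Rightarrow> bool" where
  "cox_connected m J \<longleftrightarrow>
     (\<forall>i\<in>J. \<forall>j\<in>J. (i, j) \<in> {(k, l). k \<in> J \<and> l \<in> J \<and> k \<noteq> l \<and> m k l \<noteq> 2}\<^sup>*)"

definition matrix_A :: "nat \<Rightarrow> nat \<Rightarrow> nat" where
  "matrix_A i j = (if i = j then 1 else if i = Suc j \<or> j = Suc i then 3 else 2)"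

section \<open>The 0-Hecke algebra and the monoid operation\<close>

text \<open>With concatenation as addition on lists, the convolution product on finitely supported
  functions \<open>'i list \<Rightarrow>\<^sub>0 int\<close> makes them the free associative ring on \<open>'i\<close>.\<close>

instantiation list :: (type) monoid_add
begin
definition zero_list :: "'a list" where "zero_list = []"
definition plus_list :: "'a list \<Rightarrow> 'a list \<Rightarrow> 'a list" where "plus_list u v = u @ v"
instance by standard (simp_all add: zero_list_def plus_list_def)
end

definition free_algebra :: "'i set \<Rightarrow> ('i list \<Rightarrow>\<^sub>0 int) ring" where
  "free_algebra I = \<lparr>carrier = {p. Poly_Mapping.keys p \<subseteq> lists I},
     mult = (*), one = 1, zero = 0, add = (+)\<rparr>"

abbreviation word_mono :: "'i list \<Rightarrow> ('i list \<Rightarrow>\<^sub>0 int)" where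
  "word_mono u \<equiv> Poly_Mapping.single u 1"

definition hecke_relations :: "'i set \<Rightarrow> ('i \<Rightarrow> 'i \<Rightarrow> nat) \<Rightarrow> ('i list \<Rightarrow>\<^sub>0 int) set" where
  "hecke_relations I m =
     {word_mono [i, i] - word_mono [i] | i. i \<in> I} \<union>
     {word_mono (alternating (m i j) i j) - word_mono (alternating (m i j) j i) | i j. i \<in> I \<and> j \<in> I}"

definition hecke_ideal :: "'i set \<Rightarrow> ('i \<Rightarrow> 'i \<Rightarrow> nat) \<Rightarrow> ('i list \<Rightarrow>\<^sub>0 int) set" where
  "hecke_ideal I m = genideal (free_algebra I) (hecke_relations I m)"

definition hecke0 :: "'i set \<Rightarrow> ('i \<Rightarrow> 'i \<Rightarrow> nat) \<Rightarrow> ('i list \<Rightarrow>\<^sub>0 int) set ring" where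
  "hecke0 I m = free_algebra I Quot hecke_ideal I m"

definition T_gen :: "'i set \<Rightarrow> ('i \<Rightarrow> 'i \<Rightarrow> nat) \<Rightarrow> 'i \<Rightarrow> ('i list \<Rightarrow>\<^sub>0 int) set" where
  "T_gen I m i = hecke_ideal I m +>\<^bsub>free_algebra I\<^esub> word_mono [i]"

definition T_elem ::
  "('w, 'x) monoid_scheme \<Rightarrow> 'i set \<Rightarrow> ('i \<Rightarrow> 'i \<Rightarrow> nat) \<Rightarrow> ('i \<Rightarrow> 'w) \<Rightarrow> 'w \<Rightarrow> ('i list \<Rightarrow>\<^sub>0 int) set" where
  "T_elem W I m s w = (THE t. \<forall>u. reduced_word W I s w u \<longrightarrow> word_prod (hecke0 I m) (T_gen I m) u = t)"

definition demazure ::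
  "('w, 'x) monoid_scheme \<Rightarrow> 'i set \<Rightarrow> ('i \<Rightarrow> 'i \<Rightarrow> nat) \<Rightarrow> ('i \<Rightarrow> 'w) \<Rightarrow> 'w \<Rightarrow> 'w \<Rightarrow> 'w" where
  "demazure W I m s x y = (THE z. z \<in> carrier W \<and>
     T_elem W I m s x \<otimes>\<^bsub>hecke0 I m\<^esub> T_elem W I m s y = T_elem W I m s z)"

definition cox_star ::
  "('w, 'x) monoid_scheme \<Rightarrow> 'i set \<Rightarrow> ('i \<Rightarrow> 'i \<Rightarrow> nat) \<Rightarrow> ('i \<Rightarrow> 'w) \<Rightarrow> 'i set \<Rightarrow> 'i set \<Rightarrow> 'i set" where
  "cox_star W I m s J1 J2 = (THE K. K \<subseteq> I \<and>
     demazure W I m s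
       (longest W I s J1 \<otimes>\<^bsub>W\<^esub> longest W I s I)
       (longest W I s J2 \<otimes>\<^bsub>W\<^esub> longest W I s I) =
     longest W I s K \<otimes>\<^bsub>W\<^esub> longest W I s I)"

end

theory Submission
  imports Defs "HOL-Combinatorics.Permutations"
begin

text \<open>
  Represent an element of the Coxeter group of type \<open>A\<^sub>n\<close> by the one-line notation of its inverse, a
  sequence of \<open>n + 1\<close> distinct entries. Then \<open>s\<^sub>i \<ast> w\<close> is obtained by sorting the entries at
  positions \<open>i\<close> and \<open>i + 1\<close> into decreasing order. For \<open>J = {a..c}\<close> the element
  \<open>w\<^sub>0\<^sup>J w\<^sub>0\<^sup>I\<close> is the decreasing sequence in which the entries at positions \<open>a, \<dots>, c + 1\<close> are put into
  increasing order. A bubble pass from right to left removes the first position from the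
  increasing block, and a pass from left to right removes the last one
  (\<open>sorts_upt_coset_perm\<close>, \<open>sorts_rev_upt_coset_perm\<close>). Starting from the
  identity, which is the case \<open>J = I\<close>, it takes \<open>a - 1\<close> passes of the first kind and \<open>b\<close> of the second
  to reach \<open>J\<^sub>1 = {a..n - b}\<close>. So multiplying by that element performs these same passes on
  the sequence of \<open>J\<^sub>2\<close>, and the numbers of passes add up. Once the block is used up further passes
  have no effect, which matches the empty interval in the claim.

  To connect this with the 0-Hecke algebra and the presented group, three facts are
  needed: words with equal permutations are equal in the group (\<open>wp_eq_iff\<close>), words are equal in the
  algebra exactly if they sort the identity alike (\<open>hecke0_word_eq_iff_sort\<close>), and the reduced words
  are those in which every letter acts on an ascent (\<open>reduced_word_iff\<close>). The first two rest on one
  reduction to insertion normal forms, \<open>normal_form\<close>, valid in every monoid with the braid relations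
  in which the square of a generator is the generator or the identity. The separation of
  classes in the algebra comes from the linear extension of the sorting operators, whose
  kernel contains the Hecke ideal. Longest elements are identified by the order pattern of their
  permutations (\<open>reverses_unique\<close>, \<open>longest_word\<close>).
\<close>

section \<open>Adjacent swaps and adjacent sorting\<close>

text \<open>In a word a letter \<open>i\<close> acts on sequences \<open>p\<close>, the last letter first. Swapping the entries at
  positions \<open>i\<close> and \<open>i + 1\<close> is left multiplication by \<open>s\<^sub>i\<close> when \<open>w\<close> is recorded as the one-line
  notation \<open>p\<close> of its inverse; \<open>s\<^sub>i w\<close> is longer than \<open>w\<close> exactly if \<open>p i < p (i + 1)\<close>. Hence
  putting the larger of the two entries first is the operation that takes \<open>w\<close> to
  \<open>s\<^sub>i \<ast> w\<close>.\<close>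

definition swap_at :: "nat \<Rightarrow> (nat \<Rightarrow> nat) \<Rightarrow> nat \<Rightarrow> nat" where
  "swap_at i p = p(i := p (Suc i), Suc i := p i)"

definition sort_at :: "nat \<Rightarrow> (nat \<Rightarrow> nat) \<Rightarrow> nat \<Rightarrow> nat" where
  "sort_at i p = p(i := max (p i) (p (Suc i)), Suc i := min (p i) (p (Suc i)))"

abbreviation swaps :: "nat list \<Rightarrow> (nat \<Rightarrow> nat) \<Rightarrow> nat \<Rightarrow> nat" where
  "swaps \<equiv> foldr swap_at"

abbreviation sorts :: "nat list \<Rightarrow> (nat \<Rightarrow> nat) \<Rightarrow> nat \<Rightarrow> nat" where
  "sorts \<equiv> foldr sort_at"

lemma foldr_append_comp: "foldr f (u @ v) = foldr f u \<circ> foldr f v"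
  by (simp add: fun_eq_iff)

lemma swap_at_swap_at [simp]: "swap_at i (swap_at i p) = p"
  by (auto simp: swap_at_def fun_eq_iff)

lemma swap_at_commute: "Suc i < j \<Longrightarrow> swap_at i (swap_at j p) = swap_at j (swap_at i p)"
  by (auto simp: swap_at_def fun_eq_iff)

lemma swap_at_braid:
  "swap_at i (swap_at (Suc i) (swap_at i p)) = swap_at (Suc i) (swap_at i (swap_at (Suc i) p))"
  by (auto simp: swap_at_def fun_eq_iff)

lemma sort_at_sort_at [simp]: "sort_at i (sort_at i p) = sort_at i p"
  by (auto simp: sort_at_def fun_eq_iff)

lemma sort_at_commute: "Suc i < j \<Longrightarrow> sort_at i (sort_at j p) = sort_at j (sort_at i p)"
  by (auto simp: sort_at_def fun_eq_iff)

text \<open>Both sides sort the three entries into decreasing order. So the idempotent operators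
  \<^const>\<open>sort_at\<close> satisfy the relations of the 0-Hecke monoid, which gives a representation
  of the 0-Hecke algebra without any prior knowledge of its basis.\<close>

lemma sort_at_braid:
  "sort_at i (sort_at (Suc i) (sort_at i p)) = sort_at (Suc i) (sort_at i (sort_at (Suc i) p))"
  by (auto simp: sort_at_def fun_eq_iff max_def min_def)

lemma sort_at_ascent: "p i \<le> p (Suc i) \<Longrightarrow> sort_at i p = swap_at i p"
  by (auto simp: sort_at_def swap_at_def fun_eq_iff)

lemma sort_at_descent: "p (Suc i) \<le> p i \<Longrightarrow> sort_at i p = p"
  by (auto simp: sort_at_def fun_eq_iff)

lemma sorts_descents: "(\<And>i. i \<in> set u \<Longrightarrow> p (Suc i) \<le> p i) \<Longrightarrow> sorts u p = p"
  by (induction u) (auto simp: sort_at_descent)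

lemma swap_at_transpose: "swap_at i p = p \<circ> transpose i (Suc i)"
  by (auto simp: swap_at_def fun_eq_iff transpose_def)

definition word_perm :: "nat list \<Rightarrow> nat \<Rightarrow> nat" where
  "word_perm u = swaps u id"

definition word_sort :: "nat list \<Rightarrow> nat \<Rightarrow> nat" where
  "word_sort u = sorts u id"

lemma word_perm_simps [simp]:
  "word_perm [] = id"
  "word_perm (i # u) = swap_at i (word_perm u)"
  by (simp_all add: word_perm_def)

lemma word_perm_append: "word_perm (u @ v) = swaps u (word_perm v)"
  by (simp add: word_perm_def)

text \<open>Because of the passage to inverses, concatenation of words reverses the composition of the
  permutations.\<close>

lemma swaps_comp: "swaps u p = p \<circ> word_perm u"
  by (induction u) (simp_all add: swap_at_transpose o_assoc)

lemma word_perm_permutes: "u \<in> lists {1..n} \<Longrightarrow> word_perm u permutes {1..Suc n}"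
proof (induction u rule: list.induct)
  case (Cons i u)
  then have "transpose i (Suc i) permutes {1..Suc n}" "word_perm u permutes {1..Suc n}"
    by (auto intro: permutes_swap_id)
  then show ?case unfolding word_perm_simps swap_at_transpose by (rule permutes_compose)
qed (simp add: permutes_id)

section \<open>Inversions\<close>

text \<open>The number of inversions is the Coxeter length. It changes by one under every swap, so a word
  has as many letters as its permutation has inversions exactly if each swap, read from the right,
  acts on an ascent; on such a word sorting and swapping coincide.\<close>

definition inversions :: "nat \<Rightarrow> (nat \<Rightarrow> nat) \<Rightarrow> (nat \<times> nat) set" where
  "inversions N p = {(i, j). 1 \<le> i \<and> i < j \<and> j \<le> N \<and> p j < p i}"

lemma finite_inversions [simp]: "finite (inversions N p)"
  by (rule finite_subset[of _ "{1..N} \<times> {1..N}"]) (auto simp: inversions_def)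

text \<open>Apart from the new inversion \<open>(i, i + 1)\<close>, the transposition of \<open>i\<close> and \<open>i + 1\<close> maps the old
  inversions bijectively onto the new ones.\<close>

lemma card_inversions_ascent:
  assumes i: "1 \<le> i" "i < N" and asc: "p i < p (Suc i)"
  shows "card (inversions N (swap_at i p)) = Suc (card (inversions N p))"
proof -
  define t where "t = transpose i (Suc i)"
  have t: "t (t j) = j" "swap_at i p j = p (t j)" for j
    by (auto simp: t_def swap_at_transpose)
  have tl: "t j < t k" if "j < k" "(j, k) \<noteq> (i, Suc i)" for j k
    using that by (auto simp: t_def transpose_def)
  have tN: "1 \<le> t j" "t j \<le> N" if "1 \<le> j" "j \<le> N" for j
    using that i by (auto simp: t_def transpose_def)
  have notin: "(i, Suc i) \<notin> inversions N p"
    using asc by (auto simp: inversions_def)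
  have ti: "t i = Suc i" "t (Suc i) = i" by (auto simp: t_def)
  have "inversions N (swap_at i p) = insert (i, Suc i) (map_prod t t ` inversions N p)" (is "?L = ?R")
  proof (intro equalityI subsetI)
    fix x assume x: "x \<in> ?L"
    obtain j k where jk: "x = (j, k)" by force
    with x have *: "1 \<le> j" "j < k" "k \<le> N" "p (t k) < p (t j)"
      by (auto simp: inversions_def t)
    show "x \<in> ?R"
    proof (cases "(j, k) = (i, Suc i)")
      case False
      then have "(t j, t k) \<in> inversions N p"
        using * tl[of j k] tN[of j] tN[of k] by (auto simp: inversions_def)
      then have "map_prod t t (t j, t k) \<in> map_prod t t ` inversions N p" by blast
      then show ?thesis using jk by (simp add: t)
    qed (use jk in auto)
  next
    fix x assume "x \<in> ?R"
    then consider "x = (i, Suc i)" | j k where "x = (t j, t k)" "(j, k) \<in> inversions N p"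
      by auto
    then show "x \<in> ?L"
    proof cases
      case 1
      then show ?thesis using i asc by (auto simp: inversions_def t ti)
    next
      case 2
      then have *: "1 \<le> j" "j < k" "k \<le> N" "p k < p j" "(j, k) \<noteq> (i, Suc i)"
        using notin by (auto simp: inversions_def)
      then show ?thesis
        using 2(1) tl[of j k] tN[of j] tN[of k] by (auto simp: inversions_def t)
    qed
  qed
  moreover have "(i, Suc i) \<notin> map_prod t t ` inversions N p"
  proof
    assume "(i, Suc i) \<in> map_prod t t ` inversions N p"
    then obtain j k where jk: "(j, k) \<in> inversions N p" "t j = i" "t k = Suc i" by auto
    then have "j = Suc i" "k = i" using ti t(1)[of j] t(1)[of k] by auto
    then show False using jk by (auto simp: inversions_def)
  qed
  moreover have "inj_on (map_prod t t) (inversions N p)"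
    by (auto simp: inj_on_def) (metis t(1))+
  ultimately show ?thesis by (simp add: card_image)
qed

lemma card_inversions_descent:
  assumes "1 \<le> i" "i < N" "p (Suc i) < p i"
  shows "card (inversions N p) = Suc (card (inversions N (swap_at i p)))"
proof -
  have "swap_at i p i < swap_at i p (Suc i)" using assms(3) by (simp add: swap_at_def)
  from card_inversions_ascent[OF assms(1,2) this] show ?thesis by simp
qed

fun ascending :: "nat list \<Rightarrow> (nat \<Rightarrow> nat) \<Rightarrow> bool" where
  "ascending [] p = True"
| "ascending (i # u) p \<longleftrightarrow> swaps u p i < swaps u p (Suc i) \<and> ascending u p"

lemma ascending_append: "ascending (u @ v) p \<longleftrightarrow> ascending u (swaps v p) \<and> ascending v p"
  by (induction u) auto

lemma ascending_sorts: "ascending u p \<Longrightarrow> sorts u p = swaps u p"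
  by (induction u) (auto simp: sort_at_ascent)

text \<open>The reduced words, as \<open>card_inversions_word\<close> and \<open>reduced_word_iff\<close> below make precise.\<close>

definition increasing :: "nat list \<Rightarrow> bool" where
  "increasing u \<longleftrightarrow> ascending u id"

lemma increasing_simps [simp]:
  "increasing []"
  "increasing (i # u) \<longleftrightarrow> word_perm u i < word_perm u (Suc i) \<and> increasing u"
  by (simp_all add: increasing_def word_perm_def)

lemma increasing_append: "increasing (u @ v) \<longleftrightarrow> ascending u (word_perm v) \<and> increasing v"
  by (simp add: increasing_def word_perm_def ascending_append)

lemma increasing_sort: "increasing u \<Longrightarrow> word_sort u = word_perm u"
  by (simp add: increasing_def word_perm_def word_sort_def ascending_sorts)

lemma card_inversions_word:
  assumes "u \<in> lists {1..n}"
  shows "card (inversions (Suc n) (word_perm u)) \<le> length u \<and>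
    (card (inversions (Suc n) (word_perm u)) = length u \<longleftrightarrow> increasing u)"
  using assms
proof (induction u rule: list.induct)
  case Nil
  have "inversions (Suc n) id = {}" by (auto simp: inversions_def)
  then have "card (inversions (Suc n) id) = 0" by (simp only: card.empty)
  then show ?case unfolding word_perm_simps by (simp only: list.size increasing_simps order.refl simp_thms)
next
  case (Cons i u)
  then have i: "1 \<le> i" "i < Suc n" and u: "u \<in> lists {1..n}" by auto
  have "inj (word_perm u)" using word_perm_permutes[OF u] by (rule permutes_inj)
  then consider "word_perm u i < word_perm u (Suc i)" | "word_perm u (Suc i) < word_perm u i"
    by (metis injD linorder_neqE_nat n_not_Suc_n)
  then show ?case
  proof cases
    case 1
    then show ?thesis using card_inversions_ascent[OF i 1] Cons.IH[OF u] by simp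
  next
    case 2
    then show ?thesis using card_inversions_descent[OF i 2] Cons.IH[OF u] by simp
  qed
qed

section \<open>Moving one entry across a block\<close>

lemma swaps_upt:
  assumes "k \<le> r"
  shows "swaps [k..<r] p = (\<lambda>j. if j = k then p r else if k < j \<and> j \<le> r then p (j - 1) else p j)"
  using assms
proof (induction k rule: inc_induct)
  case base
  then show ?case by (auto simp: fun_eq_iff)
next
  case (step k)
  have "swaps [k..<r] p = swap_at k (swaps [Suc k..<r] p)"
    using step.hyps by (simp add: upt_conv_Cons)
  also have "\<dots> = (\<lambda>j. if j = k then p r else if k < j \<and> j \<le> r then p (j - 1) else p j)"
    unfolding step.IH using step.hyps by (auto simp: swap_at_def fun_eq_iff)
  finally show ?case .
qed

lemma swaps_rev_upt:
  assumes "k \<le> r"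
  shows "swaps (rev [k..<r]) p = (\<lambda>j. if j = r then p k else if k \<le> j \<and> j < r then p (Suc j) else p j)"
  using assms
proof (induction r rule: dec_induct)
  case base
  then show ?case by (auto simp: fun_eq_iff)
next
  case (step r)
  have "swaps (rev [k..<Suc r]) p = swap_at r (swaps (rev [k..<r]) p)"
    using step.hyps by simp
  also have "\<dots> = (\<lambda>j. if j = Suc r then p k else if k \<le> j \<and> j < Suc r then p (Suc j) else p j)"
    unfolding step.IH using step.hyps by (auto simp: swap_at_def fun_eq_iff)
  finally show ?case .
qed

lemma ascending_upt:
  assumes "k \<le> r" "\<And>j. k \<le> j \<Longrightarrow> j < r \<Longrightarrow> p j < p r"
  shows "ascending [k..<r] p"
  using assms
proof (induction k rule: inc_induct)
  case (step k)
  then show ?case by (simp add: upt_conv_Cons swaps_upt)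
qed simp

lemma ascending_rev_upt:
  assumes "k \<le> r" "\<And>j. k < j \<Longrightarrow> j \<le> r \<Longrightarrow> p k < p j"
  shows "ascending (rev [k..<r]) p"
  using assms
proof (induction r rule: dec_induct)
  case (step r)
  then show ?case by (simp add: swaps_rev_upt)
qed simp

section \<open>Normal forms\<close>

text \<open>The words \<open>[k..<n + 2] @ v\<close> build a permutation of \<open>n + 2\<close> entries by insertion: \<open>v\<close> arranges the
  first \<open>n + 1\<close> entries and the block moves the largest entry from the end to position \<open>k\<close>. For
  \<open>k = n + 2\<close> the block is empty.\<close>

fun normal_words :: "nat \<Rightarrow> nat list set" where
  "normal_words 0 = {[]}"
| "normal_words (Suc n) = {[k..<n + 2] @ v | k v. k \<in> {1..n + 2} \<and> v \<in> normal_words n}"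

lemma normal_words_lists: "v \<in> normal_words n \<Longrightarrow> v \<in> lists {1..n}"
proof (induction n arbitrary: v)
  case (Suc n)
  then obtain k w where "v = [k..<n + 2] @ w" "1 \<le> k" "w \<in> lists {1..n}" by auto
  then show ?case by (auto simp: in_lists_conv_set simp del: upt_Suc)
qed simp

lemma swaps_normal_word_fixes:
  assumes "v \<in> normal_words n" "Suc n < j"
  shows "word_perm v j = j"
  using word_perm_permutes[OF normal_words_lists[OF assms(1)]] assms(2) by (simp add: permutes_not_in)

text \<open>The entry moved by a block exceeds all entries that it passes.\<close>

lemma normal_word_increasing: "v \<in> normal_words n \<Longrightarrow> increasing v"
proof (induction n arbitrary: v)
  case (Suc n)
  then obtain k w where v: "v = [k..<n + 2] @ w" "1 \<le> k" "k \<le> n + 2" "w \<in> normal_words n" by auto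
  have perm: "word_perm w permutes {1..Suc n}"
    using v by (intro word_perm_permutes normal_words_lists)
  have "ascending [k..<n + 2] (word_perm w)"
  proof (rule ascending_upt)
    fix j assume j: "k \<le> j" "j < n + 2"
    then have "word_perm w j \<in> {1..Suc n}"
      using v(2) by (intro permutes_in_image[OF perm, THEN iffD2]) auto
    then show "word_perm w j < word_perm w (n + 2)"
      using swaps_normal_word_fixes[OF v(4), of "n + 2"] by auto
  qed (use v in auto)
  then show ?case using v Suc.IH by (simp add: increasing_append del: upt_Suc)
qed simp

text \<open>The position of the largest entry determines \<open>k\<close>, and undoing the insertion determines \<open>v\<close>.\<close>

lemma normal_word_unique:
  "\<lbrakk>v \<in> normal_words n; w \<in> normal_words n; word_perm v = word_perm w\<rbrakk> \<Longrightarrow> v = w"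
proof (induction n arbitrary: v w)
  case (Suc n)
  obtain k v' where v: "v = [k..<n + 2] @ v'" "1 \<le> k" "k \<le> n + 2" "v' \<in> normal_words n"
    using Suc.prems(1) by auto
  obtain l w' where w: "w = [l..<n + 2] @ w'" "1 \<le> l" "l \<le> n + 2" "w' \<in> normal_words n"
    using Suc.prems(2) by auto
  have top: "word_perm ([i..<n + 2] @ u) i = n + 2" if "i \<le> n + 2" "u \<in> normal_words n" for i u
    using that swaps_normal_word_fixes[OF that(2), of "n + 2"]
    by (simp add: swaps_upt word_perm_append del: upt_Suc)
  have "inj (word_perm v)"
    by (rule permutes_inj[OF word_perm_permutes[OF normal_words_lists[OF Suc.prems(1)]]])
  then have kl: "k = l"
    using top[of k v'] top[of l w'] v w Suc.prems(3) by (metis injD)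
  \<comment> \<open>the word read backwards inverts the insertion step\<close>
  have undo: "swaps (rev u) (swaps u p) = p" for u p
    by (induction u arbitrary: p) simp_all
  have "word_perm v' = word_perm w'"
    using Suc.prems(3) undo[of "[k..<n + 2]" "word_perm v'"] undo[of "[k..<n + 2]" "word_perm w'"]
    unfolding v(1) w(1) kl word_perm_append by metis
  then show ?case using Suc.IH v w kl by simp
qed simp

section \<open>Block reversals\<close>

text \<open>This characterises the longest element of a standard parabolic subgroup: every generator in \<open>J\<close>
  is a descent, and the condition for \<open>k \<notin> J\<close> says that the permutation preserves the
  blocks into which \<open>J\<close> cuts the positions. The permutation is determined by \<open>J\<close>, and conversely.\<close>

definition reverses :: "nat \<Rightarrow> nat set \<Rightarrow> (nat \<Rightarrow> nat) \<Rightarrow> bool" where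
  "reverses n J p \<longleftrightarrow> p permutes {1..Suc n} \<and> (\<forall>i\<in>J. p (Suc i) < p i) \<and>
     (\<forall>k. k \<notin> J \<longrightarrow> (\<forall>i. p i \<le> k \<longleftrightarrow> i \<le> k))"

text \<open>An entry of a permutation is its rank, so a permutation is determined by the order of its entries.\<close>

lemma permutes_eq_card:
  fixes p :: "nat \<Rightarrow> nat"
  assumes "p permutes {1..N}" "i \<in> {1..N}"
  shows "p i = card {j \<in> {1..N}. p j \<le> p i}"
proof -
  have "p ` {j \<in> {1..N}. p j \<le> p i} = {1..p i}"
  proof (intro equalityI subsetI)
    fix x assume x: "x \<in> {1..p i}"
    have "p i \<in> {1..N}" using permutes_in_image[OF assms(1)] assms(2) by blast
    then have "x \<in> {1..N}" using x by auto
    then obtain j where "j \<in> {1..N}" "x = p j"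
      using permutes_image[OF assms(1)] by blast
    then show "x \<in> p ` {j \<in> {1..N}. p j \<le> p i}" using x by auto
  next
    fix x assume "x \<in> p ` {j \<in> {1..N}. p j \<le> p i}"
    then show "x \<in> {1..p i}" using permutes_in_image[OF assms(1)] by force
  qed
  moreover have "inj_on p {j \<in> {1..N}. p j \<le> p i}"
    using permutes_inj[OF assms(1)] by (rule inj_on_subset) simp
  ultimately show ?thesis by (metis card_atLeastAtMost card_image diff_Suc_1)
qed

lemma permutes_eq_if_same_order:
  fixes p q :: "nat \<Rightarrow> nat"
  assumes "p permutes {1..N}" "q permutes {1..N}"
    and "\<And>i j. i \<in> {1..N} \<Longrightarrow> j \<in> {1..N} \<Longrightarrow> p j \<le> p i \<longleftrightarrow> q j \<le> q i"
  shows "p = q"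
proof
  fix i
  show "p i = q i"
  proof (cases "i \<in> {1..N}")
    case True
    have "{j \<in> {1..N}. p j \<le> p i} = {j \<in> {1..N}. q j \<le> q i}" using assms(3) True by blast
    then show ?thesis using permutes_eq_card[OF assms(1) True] permutes_eq_card[OF assms(2) True] by simp
  qed (use assms permutes_not_in in metis)
qed

text \<open>If \<open>J\<close> contains \<open>i, \<dots>, j - 1\<close>, then the descents there chain up; otherwise a block boundary
  separates \<open>i\<close> from \<open>j\<close>. Thus the inversions depend on \<open>J\<close> only.\<close>

lemma reverses_order:
  assumes p: "reverses n J p" and "i < j"
  shows "p j < p i \<longleftrightarrow> {i..<j} \<subseteq> J"
proof
  assume "p j < p i"
  show "{i..<j} \<subseteq> J"
  proof
    fix k assume k: "k \<in> {i..<j}"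
    show "k \<in> J"
    proof (rule ccontr)
      assume "k \<notin> J"
      then have "p i \<le> k \<longleftrightarrow> i \<le> k" "p j \<le> k \<longleftrightarrow> j \<le> k" using p by (auto simp: reverses_def)
      then show False using k \<open>p j < p i\<close> by auto
    qed
  qed
next
  have "Suc i \<le> j" using \<open>i < j\<close> by simp
  then show "{i..<j} \<subseteq> J \<Longrightarrow> p j < p i"
  proof (induction j rule: dec_induct)
    case base
    then show ?case using p by (auto simp: reverses_def)
  next
    case (step j)
    then have "j \<in> J" by auto
    then have "p (Suc j) < p j" using p by (auto simp: reverses_def)
    moreover have "p j < p i" using step by (auto simp: subset_iff)
    ultimately show ?case by simp
  qed
qed

lemma reverses_unique:
  assumes "reverses n J p" "reverses n J q"
  shows "p = q"
proof (rule permutes_eq_if_same_order)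
  show p: "p permutes {1..Suc n}" and q: "q permutes {1..Suc n}"
    using assms by (auto simp: reverses_def)
  fix i j :: nat
  consider "i < j" | "i = j" | "j < i" by linarith
  then show "p j \<le> p i \<longleftrightarrow> q j \<le> q i"
  proof cases
    case 1
    moreover have "p i \<noteq> p j" "q i \<noteq> q j"
      using 1 permutes_inj[OF p] permutes_inj[OF q] by (auto dest: injD)
    ultimately show ?thesis
      using reverses_order[OF assms(1) 1] reverses_order[OF assms(2) 1] by linarith
  next
    case 3
    then show ?thesis
      using reverses_order[OF assms(1) 3] reverses_order[OF assms(2) 3] by linarith
  qed simp
qed

lemma reverses_support_unique:
  assumes "reverses n J p" "reverses n K p"
  shows "J = K"
proof -
  have "k \<in> J \<longleftrightarrow> p (Suc k) < p k" if "reverses n J p" for k J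
    using reverses_order[OF that, of k "Suc k"] by simp
  then show ?thesis using assms by blast
qed

definition block_rev :: "nat \<Rightarrow> nat \<Rightarrow> nat \<Rightarrow> nat" where
  "block_rev l r i = (if l \<le> i \<and> i \<le> r then l + r - i else i)"

lemma reverses_block_rev:
  assumes "1 \<le> a" "c \<le> n"
  shows "reverses n {a..c} (block_rev a (Suc c))"
proof -
  have inv: "block_rev a (Suc c) (block_rev a (Suc c) i) = i" for i
    by (auto simp: block_rev_def)
  have out: "block_rev a (Suc c) i = i" if "i \<notin> {1..Suc n}" for i
    using that assms by (auto simp: block_rev_def)
  have "block_rev a (Suc c) permutes {1..Suc n}"
    unfolding permutes_def using inv out by metis
  then show ?thesis by (auto simp: reverses_def block_rev_def)
qed

section \<open>The elements for intervals\<close>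

text \<open>The sequence of \<open>w\<^sub>0\<^sup>J w\<^sub>0\<^sup>I\<close> for \<open>J = {a..c}\<close>: the decreasing sequence \<open>n + 1, \<dots>, 1\<close> with the
  entries at the positions \<open>a, \<dots>, c + 1\<close> put into increasing order. For \<open>J = I\<close> it is the identity
  and for empty \<open>J\<close> it is the longest element.\<close>

definition coset_perm :: "nat \<Rightarrow> nat \<Rightarrow> nat \<Rightarrow> nat \<Rightarrow> nat" where
  "coset_perm n a c = block_rev 1 (Suc n) \<circ> block_rev a (Suc c)"

lemma coset_perm_id: "coset_perm n 1 n = id"
  by (auto simp: coset_perm_def block_rev_def fun_eq_iff)

lemma coset_perm_eq:
  assumes "1 \<le> a" "c \<le> n" "1 \<le> i" "i \<le> Suc n"
  shows "coset_perm n a c i = (if a \<le> i \<and> i \<le> Suc c then Suc n + i - (a + c) else n + 2 - i)"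
  using assms by (auto simp: coset_perm_def block_rev_def)

lemma coset_perm_descent:
  assumes "1 \<le> a" "c \<le> n" "1 \<le> i" "i \<le> n" "i \<notin> {a..c}"
  shows "coset_perm n a c (Suc i) \<le> coset_perm n a c i"
  using assms by (auto simp: coset_perm_eq)

lemma coset_perm_outside:
  assumes "1 \<le> a" "c \<le> n" "\<not> (1 \<le> i \<and> i \<le> Suc n)"
  shows "coset_perm n a c i = i"
  using assms by (auto simp: coset_perm_def block_rev_def)

lemma upt_split3: "\<lbrakk>i \<le> j; j \<le> k; k \<le> l\<rbrakk> \<Longrightarrow> [i..<l] = [i..<j] @ [j..<k] @ [k..<l]"
  by (metis le_trans upt_add_eq_append le_add_diff_inverse)

text \<open>The heart of the matter. In a bubble pass from right to left nothing happens outside the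
  increasing block; inside, the largest entry of the block travels to its left end and the
  block loses its first position. If no block is left, the sequence is already decreasing and stays
  fixed, which is why empty intervals need no special treatment.\<close>

lemma sorts_upt_coset_perm:
  assumes "1 \<le> a" "c \<le> n"
  shows "sorts [1..<Suc n] (coset_perm n a c) = coset_perm n (Suc a) c"
proof (cases "a \<le> c")
  case False
  have "sorts [1..<Suc n] (coset_perm n a c) = coset_perm n a c"
    using False assms by (intro sorts_descents coset_perm_descent) auto
  moreover have "coset_perm n a c = coset_perm n (Suc a) c"
    using False by (auto simp: coset_perm_def block_rev_def fun_eq_iff)
  ultimately show ?thesis by simp
next
  case True
  have split: "[1..<Suc n] = [1..<a] @ [a..<Suc c] @ [Suc c..<Suc n]"
    using True assms by (intro upt_split3) auto
  have right: "sorts [Suc c..<Suc n] (coset_perm n a c) = coset_perm n a c"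
    using assms by (intro sorts_descents coset_perm_descent) auto
  have "sorts [a..<Suc c] (coset_perm n a c) = swaps [a..<Suc c] (coset_perm n a c)"
    using True assms by (intro ascending_sorts ascending_upt) (auto simp: coset_perm_eq)
  also have "\<dots> = coset_perm n (Suc a) c"
  proof
    fix i
    show "swaps [a..<Suc c] (coset_perm n a c) i = coset_perm n (Suc a) c i"
    proof (cases "1 \<le> i \<and> i \<le> Suc n")
      case i: True
      have "1 \<le> i - 1" if "a < i" using that assms by simp
      then show ?thesis using True assms i
        by (auto simp: swaps_upt coset_perm_eq simp del: upt_Suc)
    next
      case False
      then show ?thesis using True assms
        by (auto simp: swaps_upt coset_perm_outside simp del: upt_Suc)
    qed
  qed
  finally have mid: "sorts [a..<Suc c] (coset_perm n a c) = coset_perm n (Suc a) c" .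
  have "sorts [1..<a] (coset_perm n (Suc a) c) = coset_perm n (Suc a) c"
    using True assms by (intro sorts_descents coset_perm_descent) auto
  then show ?thesis by (simp only: split foldr_append o_apply right mid)
qed

text \<open>In the opposite pass the smallest entry of the block travels to its right end. For \<open>c = 0\<close> the
  truncated \<open>c - 1\<close> is harmless, as the interval is empty already.\<close>

lemma sorts_rev_upt_coset_perm:
  assumes "1 \<le> a" "c \<le> n"
  shows "sorts (rev [1..<Suc n]) (coset_perm n a c) = coset_perm n a (c - 1)"
proof (cases "a \<le> c")
  case False
  have "sorts (rev [1..<Suc n]) (coset_perm n a c) = coset_perm n a c"
    using False assms by (intro sorts_descents coset_perm_descent) auto
  moreover have "coset_perm n a c = coset_perm n a (c - 1)"
    using False by (auto simp: coset_perm_def block_rev_def fun_eq_iff)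
  ultimately show ?thesis by simp
next
  case True
  have "[1..<Suc n] = [1..<a] @ [a..<Suc c] @ [Suc c..<Suc n]"
    using True assms by (intro upt_split3) auto
  then have split: "rev [1..<Suc n] = rev [Suc c..<Suc n] @ rev [a..<Suc c] @ rev [1..<a]"
    by (simp del: upt_Suc)
  have right: "sorts (rev [1..<a]) (coset_perm n a c) = coset_perm n a c"
    using True assms by (intro sorts_descents coset_perm_descent) auto
  have "sorts (rev [a..<Suc c]) (coset_perm n a c) = swaps (rev [a..<Suc c]) (coset_perm n a c)"
    using True assms by (intro ascending_sorts ascending_rev_upt) (auto simp: coset_perm_eq)
  also have "\<dots> = coset_perm n a (c - 1)"
  proof
    fix i
    show "swaps (rev [a..<Suc c]) (coset_perm n a c) i = coset_perm n a (c - 1) i"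
    proof (cases "1 \<le> i \<and> i \<le> Suc n")
      case i: True
      then show ?thesis using True assms
        by (auto simp: swaps_rev_upt coset_perm_eq simp del: upt_Suc)
    next
      case False
      then show ?thesis using True assms
        by (auto simp: swaps_rev_upt coset_perm_outside simp del: upt_Suc)
    qed
  qed
  finally have mid: "sorts (rev [a..<Suc c]) (coset_perm n a c) = coset_perm n a (c - 1)" .
  have "sorts (rev [Suc c..<Suc n]) (coset_perm n a (c - 1)) = coset_perm n a (c - 1)"
    using True assms by (intro sorts_descents coset_perm_descent) auto
  then show ?thesis by (simp only: split foldr_append o_apply right mid)
qed

text \<open>An explicit word for \<open>w\<^sub>0\<^sup>J w\<^sub>0\<^sup>I\<close> with \<open>J = {p + 1..n - q}\<close>, in the sense of the star operation: \<open>p\<close>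
  passes of one kind after \<open>q\<close> passes of the other. It is in general far from reduced.\<close>

definition shift_word :: "nat \<Rightarrow> nat \<Rightarrow> nat \<Rightarrow> nat list" where
  "shift_word n p q = concat (replicate p [1..<Suc n]) @ concat (replicate q (rev [1..<Suc n]))"

lemma shift_word_lists: "shift_word n p q \<in> lists {1..n}"
  by (auto simp: shift_word_def in_lists_conv_set simp del: upt_Suc)

lemma sorts_shift_word:
  assumes "1 \<le> a" "c \<le> n"
  shows "sorts (shift_word n p q) (coset_perm n a c) = coset_perm n (a + p) (c - q)"
proof -
  have down: "sorts (concat (replicate q (rev [1..<Suc n]))) (coset_perm n a c) = coset_perm n a (c - q)"
  proof (induction q)
    case (Suc q)
    then show ?case using assms sorts_rev_upt_coset_perm[of a "c - q" n]
      by (simp del: upt_Suc)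
  qed simp
  have up: "sorts (concat (replicate p [1..<Suc n])) (coset_perm n a d) = coset_perm n (a + p) d"
    if "d \<le> n" for d
  proof (induction p)
    case (Suc p)
    then show ?case using assms that sorts_upt_coset_perm[of "a + p" d n]
      by (simp del: upt_Suc One_nat_def)
  qed simp
  show ?thesis using assms up[of "c - q"] by (simp only: shift_word_def concat_append foldr_append o_apply down)
qed

section \<open>Normal forms in monoids with braid relations\<close>

lemma word_prod_Nil [simp]: "word_prod G t [] = \<one>\<^bsub>G\<^esub>"
  by (simp add: word_prod_def)

lemma word_prod_Cons [simp]: "word_prod G t (i # u) = t i \<otimes>\<^bsub>G\<^esub> word_prod G t u"
  by (simp add: word_prod_def)

context monoid
begin

lemma word_prod_closed:
  assumes "t \<in> I \<rightarrow> carrier G" "u \<in> lists I"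
  shows "word_prod G t u \<in> carrier G"
  using assms(2) by (induction u rule: list.induct) (use assms(1) in auto)

lemma word_prod_append:
  assumes "t \<in> I \<rightarrow> carrier G" "u \<in> lists I" "v \<in> lists I"
  shows "word_prod G t (u @ v) = word_prod G t u \<otimes> word_prod G t v"
  using assms(2)
proof (induction u rule: list.induct)
  case (Cons i u)
  then have "t i \<in> carrier G" "word_prod G t u \<in> carrier G" "word_prod G t v \<in> carrier G"
    using assms word_prod_closed[of t I] by auto
  then show ?case using Cons by (simp add: m_assoc)
qed (use assms word_prod_closed[of t I] in auto)

end

text \<open>The relations shared by the Coxeter group and the 0-Hecke monoid of type A. The two differ in
  the value of \<open>t i \<otimes> t i\<close>, and the reduction to normal form works for both.\<close>

locale braid_monoid = monoid G for G (structure) +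
  fixes n :: nat and t :: "nat \<Rightarrow> 'a"
  assumes gen: "t \<in> {1..n} \<rightarrow> carrier G"
    and commute: "\<lbrakk>1 \<le> i; Suc i < j; j \<le> n\<rbrakk> \<Longrightarrow> t i \<otimes> t j = t j \<otimes> t i"
    and braid: "\<lbrakk>1 \<le> i; Suc i \<le> n\<rbrakk> \<Longrightarrow>
      t i \<otimes> (t (Suc i) \<otimes> t i) = t (Suc i) \<otimes> (t i \<otimes> t (Suc i))"
    and square: "\<lbrakk>1 \<le> i; i \<le> n\<rbrakk> \<Longrightarrow> t i \<otimes> t i \<in> {t i, \<one>}"
begin

lemma gen_closed: "\<lbrakk>1 \<le> i; i \<le> n\<rbrakk> \<Longrightarrow> t i \<in> carrier G"
  using gen by auto

lemmas prod_closed = word_prod_closed[OF gen]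
lemmas prod_append = word_prod_append[OF gen]

lemma commute_word:
  assumes "1 \<le> i" "i \<le> n" "u \<in> lists {1..n}" "\<And>j. j \<in> set u \<Longrightarrow> Suc i < j \<or> Suc j < i"
  shows "t i \<otimes> word_prod G t u = word_prod G t u \<otimes> t i"
  using assms(3,4)
proof (induction u rule: list.induct)
  case Nil
  then show ?case using gen_closed assms by simp
next
  case (Cons j u)
  have j: "Suc i < j \<or> Suc j < i" "1 \<le> j" "j \<le> n" and u: "u \<in> lists {1..n}"
    using Cons.prems by auto
  have c: "t i \<in> carrier G" "t j \<in> carrier G" "word_prod G t u \<in> carrier G"
    by (rule gen_closed[OF assms(1,2)] gen_closed[OF j(2,3)] prod_closed[OF u])+
  have ij: "t i \<otimes> t j = t j \<otimes> t i" using commute[of i j] commute[of j i] assms j by auto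
  have "t i \<otimes> (t j \<otimes> word_prod G t u) = (t i \<otimes> t j) \<otimes> word_prod G t u"
    using c by (simp add: m_assoc)
  also have "\<dots> = t j \<otimes> (t i \<otimes> word_prod G t u)"
    using c by (simp add: ij m_assoc)
  also have "\<dots> = t j \<otimes> (word_prod G t u \<otimes> t i)"
    using Cons by simp
  finally show ?case using c by (simp add: m_assoc)
qed

text \<open>A letter that meets the ascending block beyond its start passes through it by one braid move and
  comes out lowered by one.\<close>

lemma slide:
  assumes "1 \<le> k" "k \<le> j" "Suc j \<le> m" "m \<le> n"
  shows "t (Suc j) \<otimes> word_prod G t [k..<Suc m] = word_prod G t [k..<Suc m] \<otimes> t j"
proof -
  define x y A B where "x = t j" and "y = t (Suc j)"
    and "A = word_prod G t [k..<j]" and "B = word_prod G t [Suc (Suc j)..<Suc m]"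
  have lists: "[k..<j] \<in> lists {1..n}" "[Suc (Suc j)..<Suc m] \<in> lists {1..n}"
    using assms by (auto simp: in_lists_conv_set simp del: upt_Suc)
  have c: "x \<in> carrier G" "y \<in> carrier G" "A \<in> carrier G" "B \<in> carrier G"
    unfolding x_def y_def A_def B_def using assms lists by (auto intro!: gen_closed prod_closed)
  have "[k..<Suc m] = [k..<j] @ [j..<Suc (Suc j)] @ [Suc (Suc j)..<Suc m]"
    using assms by (intro upt_split3) auto
  then have "[k..<Suc m] = [k..<j] @ (j # Suc j # [Suc (Suc j)..<Suc m])" by simp
  moreover have "j # Suc j # [Suc (Suc j)..<Suc m] \<in> lists {1..n}" using assms by auto
  ultimately have word: "word_prod G t [k..<Suc m] = A \<otimes> (x \<otimes> (y \<otimes> B))"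
    using lists by (simp add: prod_append A_def B_def x_def y_def del: upt_Suc)
  have yA: "y \<otimes> A = A \<otimes> y" unfolding y_def A_def
    using assms lists by (intro commute_word) auto
  have xB: "x \<otimes> B = B \<otimes> x" unfolding x_def B_def
    using assms lists by (intro commute_word) auto
  have br: "x \<otimes> (y \<otimes> x) = y \<otimes> (x \<otimes> y)"
    unfolding x_def y_def using assms by (intro braid) auto
  have "y \<otimes> (A \<otimes> (x \<otimes> (y \<otimes> B))) = (y \<otimes> A) \<otimes> (x \<otimes> (y \<otimes> B))"
    using c by (simp add: m_assoc)
  also have "\<dots> = A \<otimes> ((y \<otimes> (x \<otimes> y)) \<otimes> B)"
    using c by (simp add: yA m_assoc)
  also have "\<dots> = A \<otimes> (x \<otimes> (y \<otimes> (x \<otimes> B)))"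
    using c by (simp add: br[symmetric] m_assoc)
  also have "\<dots> = (A \<otimes> (x \<otimes> (y \<otimes> B))) \<otimes> x"
    using c by (simp add: xB m_assoc)
  finally show ?thesis unfolding word x_def y_def .
qed

text \<open>A letter in front of a block \<open>[k..<m + 2]\<close> slides through it (\<open>k < i\<close>), meets its own copy
  (\<open>i = k\<close>), extends it (\<open>i + 1 = k\<close>) or commutes with it (\<open>i + 1 < k\<close>). In the first and the last
  case it is absorbed by the remaining normal word.\<close>

lemma normal_word_step:
  assumes "v \<in> normal_words m" "1 \<le> i" "i \<le> m" "m \<le> n"
  shows "\<exists>v'\<in>normal_words m. t i \<otimes> word_prod G t v = word_prod G t v'"
  using assms
proof (induction m arbitrary: v i)
  case (Suc m)
  obtain k w where v: "v = [k..<m + 2] @ w" "1 \<le> k" "k \<le> m + 2" "w \<in> normal_words m"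
    using Suc.prems(1) by auto
  let ?e = "\<lambda>k. [k..<m + 2]"
  have w: "w \<in> lists {1..n}"
    using normal_words_lists[OF v(4)] Suc.prems(4) by (auto simp: in_lists_conv_set)
  have e: "?e l \<in> lists {1..n}" if "1 \<le> l" for l
    using that Suc.prems(4) by (auto simp: in_lists_conv_set simp del: upt_Suc)
  have ti: "t i \<in> carrier G" using Suc.prems gen_closed by auto
  have c: "word_prod G t (?e k) \<in> carrier G" "word_prod G t w \<in> carrier G"
    by (rule prod_closed[OF e[OF v(2)]] prod_closed[OF w])+
  have vw: "word_prod G t (?e l @ u) = word_prod G t (?e l) \<otimes> word_prod G t u"
    if "1 \<le> l" "u \<in> lists {1..n}" for l u
    using that e prod_append by simp
  have normal: "?e l @ u \<in> normal_words (Suc m)" if "1 \<le> l" "l \<le> m + 2" "u \<in> normal_words m" for l u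
    unfolding normal_words.simps mem_Collect_eq
    using that by (intro exI[of _ l] exI[of _ u]) (simp del: upt_Suc)
  have e_Cons: "?e l = l # ?e (Suc l)" if "l \<le> Suc m" for l
    using that by (simp add: upt_conv_Cons del: upt_Suc)
  \<comment> \<open>a letter that slides across the block becomes a letter in front of the shorter normal form\<close>
  have pass: ?case
    if step: "t i \<otimes> word_prod G t (?e k) = word_prod G t (?e k) \<otimes> t j" "1 \<le> j" "j \<le> m" for j
  proof -
    obtain w' where w': "w' \<in> normal_words m" "t j \<otimes> word_prod G t w = word_prod G t w'"
      using Suc.IH[OF v(4) step(2,3)] Suc.prems(4) by auto
    have w'l: "w' \<in> lists {1..n}"
      using normal_words_lists[OF w'(1)] Suc.prems(4) by (auto simp: in_lists_conv_set)
    have tj: "t j \<in> carrier G" using step Suc.prems gen_closed by auto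
    have "t i \<otimes> word_prod G t v = (t i \<otimes> word_prod G t (?e k)) \<otimes> word_prod G t w"
      unfolding v(1) vw[OF v(2) w] by (rule m_assoc[OF ti c, symmetric])
    also have "\<dots> = word_prod G t (?e k) \<otimes> (t j \<otimes> word_prod G t w)"
      unfolding step(1) by (rule m_assoc[OF c(1) tj c(2)])
    also have "\<dots> = word_prod G t (?e k @ w')"
      unfolding vw[OF v(2) w'l] w'(2) ..
    finally show ?thesis using normal[OF v(2,3) w'(1)] by (rule bexI)
  qed
  consider "k < i" | "i = k" | "Suc i = k" | "Suc i < k" by linarith
  then show ?case
  proof cases
    case 1
    then show ?thesis
      using slide[of k "i - 1" "Suc m"] v(2) Suc.prems by (intro pass[of "i - 1"]) auto
  next
    case 2
    let ?z = "word_prod G t (?e (Suc k) @ w)"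
    have z: "?z \<in> carrier G" using e[of "Suc k"] w by (intro prod_closed) (simp del: upt_Suc)
    have k: "t k \<in> carrier G" using ti 2 by simp
    have vz: "word_prod G t v = t k \<otimes> ?z"
      using e_Cons[of k] 2 Suc.prems(3) by (simp add: v(1) del: upt_Suc)
    have "t i \<otimes> word_prod G t v = (t k \<otimes> t k) \<otimes> ?z"
      using k z by (simp add: vz 2 m_assoc del: upt_Suc)
    moreover have "t k \<otimes> t k \<in> {t k, \<one>}" using square[of k] 2 Suc.prems by auto
    ultimately have "t i \<otimes> word_prod G t v \<in> {word_prod G t v, ?z}" using z vz by auto
    moreover have "?e (Suc k) @ w \<in> normal_words (Suc m)"
      using v(4) 2 Suc.prems(3) by (intro normal) auto
    ultimately show ?thesis using Suc.prems(1) by blast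
  next
    case 3
    have "t i \<otimes> word_prod G t v = word_prod G t (?e i @ w)"
      using e_Cons[of i] 3 Suc.prems(3) by (simp add: v(1) del: upt_Suc)
    moreover have "?e i @ w \<in> normal_words (Suc m)"
      using v(4) Suc.prems(2,3) by (intro normal) auto
    ultimately show ?thesis by blast
  next
    case 4
    have "t i \<otimes> word_prod G t (?e k) = word_prod G t (?e k) \<otimes> t i"
      using 4 Suc.prems e[OF v(2)] by (intro commute_word) (auto simp del: upt_Suc)
    then show ?thesis using 4 v(3) Suc.prems by (intro pass[of i]) auto
  qed
qed simp

lemma normal_form:
  assumes "u \<in> lists {1..n}"
  shows "\<exists>v\<in>normal_words n. word_prod G t u = word_prod G t v"
  using assms
proof (induction u rule: list.induct)
  case Nil
  have "[] \<in> normal_words m" for m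
  proof (induction m)
    case (Suc m)
    then have "[m + 2..<m + 2] @ [] \<in> normal_words (Suc m)"
      unfolding normal_words.simps mem_Collect_eq
      by (intro exI[of _ "m + 2"] exI[of _ "[]"]) simp
    then show ?case by simp
  qed simp
  then show ?case by blast
next
  case (Cons i u)
  then have "\<exists>v\<in>normal_words n. word_prod G t u = word_prod G t v" by simp
  then obtain v where v: "v \<in> normal_words n" "word_prod G t u = word_prod G t v" by blast
  have "1 \<le> i" "i \<le> n" using Cons.prems by auto
  then show ?case using normal_word_step[OF v(1)] v(2) by simp
qed

end

lemma normal_words_sort_unique:
  "\<lbrakk>v \<in> normal_words n; w \<in> normal_words n; word_sort v = word_sort w\<rbrakk> \<Longrightarrow> v = w"
  using increasing_sort[OF normal_word_increasing, of v n] increasing_sort[OF normal_word_increasing, of w n]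
  by (intro normal_word_unique) simp_all

section \<open>The 0-Hecke algebra\<close>

lemma free_algebra_ring: "ring (free_algebra I)"
proof (rule ringI)
  show "abelian_group (free_algebra I)"
  proof (rule abelian_groupI)
    fix x assume x: "x \<in> carrier (free_algebra I)"
    then show "\<exists>y\<in>carrier (free_algebra I). y \<oplus>\<^bsub>free_algebra I\<^esub> x = \<zero>\<^bsub>free_algebra I\<^esub>"
      by (intro bexI[of _ "- x"]) (auto simp: free_algebra_def)
  qed (use keys_add in \<open>fastforce simp: free_algebra_def algebra_simps\<close>)+
  show "Group.monoid (free_algebra I)"
  proof (rule monoidI)
    fix x y assume "x \<in> carrier (free_algebra I)" "y \<in> carrier (free_algebra I)"
    then show "x \<otimes>\<^bsub>free_algebra I\<^esub> y \<in> carrier (free_algebra I)"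
      using keys_mult[of x y] by (fastforce simp: free_algebra_def plus_list_def)
  qed (auto simp: free_algebra_def mult.assoc zero_list_def)
qed (auto simp: free_algebra_def algebra_simps)

lemma alternating_lists: "i \<in> I \<Longrightarrow> j \<in> I \<Longrightarrow> alternating k i j \<in> lists I"
  by (induction k arbitrary: i j) auto

lemma word_mono_carrier: "word_mono u \<in> carrier (free_algebra I) \<longleftrightarrow> u \<in> lists I"
  by (simp add: free_algebra_def)

lemma free_algebra_minus:
  assumes "p \<in> carrier (free_algebra I)" "q \<in> carrier (free_algebra I)"
  shows "p - q \<in> carrier (free_algebra I)" "p \<ominus>\<^bsub>free_algebra I\<^esub> q = p - q"
proof -
  interpret ring "free_algebra I" by (rule free_algebra_ring)
  have mq: "- q \<in> carrier (free_algebra I)" using assms by (simp add: free_algebra_def)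
  have "\<ominus>\<^bsub>free_algebra I\<^esub> q = - q"
    using mq assms by (intro minus_equality) (auto simp: free_algebra_def)
  then show "p \<ominus>\<^bsub>free_algebra I\<^esub> q = p - q"
    by (simp add: a_minus_def free_algebra_def)
  then show "p - q \<in> carrier (free_algebra I)" using assms by (metis minus_closed)
qed

lemma hecke_relations_carrier: "hecke_relations I m \<subseteq> carrier (free_algebra I)"
proof -
  have "word_mono u - word_mono v \<in> carrier (free_algebra I)" if "u \<in> lists I" "v \<in> lists I" for u v
    using that by (intro free_algebra_minus) (simp_all only: word_mono_carrier)
  then show ?thesis unfolding hecke_relations_def by (auto simp: alternating_lists)
qed

lemma hecke_ideal: "ideal (hecke_ideal I m) (free_algebra I)"
  unfolding hecke_ideal_def
  by (rule ring.genideal_ideal[OF free_algebra_ring hecke_relations_carrier])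

lemma hecke0_ring: "ring (hecke0 I m)"
  unfolding hecke0_def by (rule ideal.quotient_is_ring[OF hecke_ideal])

lemma T_gen_closed: "T_gen I m \<in> I \<rightarrow> carrier (hecke0 I m)"
proof
  fix i assume "i \<in> I"
  interpret H: ideal "hecke_ideal I m" "free_algebra I" by (rule hecke_ideal)
  show "T_gen I m i \<in> carrier (hecke0 I m)"
    using \<open>i \<in> I\<close> H.rcos_ring_hom
    by (auto simp: T_gen_def hecke0_def ring_hom_def word_mono_carrier)
qed

lemma word_prod_hecke0:
  assumes "u \<in> lists I"
  shows "word_prod (hecke0 I m) (T_gen I m) u = hecke_ideal I m +>\<^bsub>free_algebra I\<^esub> word_mono u"
proof -
  interpret H: ideal "hecke_ideal I m" "free_algebra I" by (rule hecke_ideal)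
  note hom = H.rcos_ring_hom[folded hecke0_def]
  show ?thesis using assms
  proof (induction u rule: list.induct)
    case Nil
    have "\<one>\<^bsub>free_algebra I\<^esub> = word_mono []" by (simp add: free_algebra_def zero_list_def[symmetric])
    then show ?case using ring_hom_one[OF hom] by simp
  next
    case (Cons i u)
    have "word_mono (i # u) = word_mono [i] \<otimes>\<^bsub>free_algebra I\<^esub> word_mono u"
      by (simp add: free_algebra_def mult_single plus_list_def)
    then show ?case
      using Cons ring_hom_mult[OF hom, of "word_mono [i]" "word_mono u"]
      by (simp add: T_gen_def word_mono_carrier)
  qed
qed

lemma hecke0_word_eq_iff:
  assumes "u \<in> lists I" "v \<in> lists I"
  shows "word_prod (hecke0 I m) (T_gen I m) u = word_prod (hecke0 I m) (T_gen I m) v \<longleftrightarrow>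
    word_mono u - word_mono v \<in> hecke_ideal I m"
proof -
  interpret H: ideal "hecke_ideal I m" "free_algebra I" by (rule hecke_ideal)
  have c: "word_mono u \<in> carrier (free_algebra I)" "word_mono v \<in> carrier (free_algebra I)"
    using assms by (simp_all only: word_mono_carrier)
  show ?thesis
    unfolding word_prod_hecke0[OF assms(1)] word_prod_hecke0[OF assms(2)]
      H.quotient_eq_iff_same_a_r_cos[OF hecke_ideal c, symmetric] free_algebra_minus(2)[OF c] ..
qed

lemma hecke_relations_word_eq:
  assumes "word_mono u - word_mono v \<in> hecke_relations I m" "u \<in> lists I" "v \<in> lists I"
  shows "word_prod (hecke0 I m) (T_gen I m) u = word_prod (hecke0 I m) (T_gen I m) v"
proof -
  have "hecke_relations I m \<subseteq> hecke_ideal I m"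
    unfolding hecke_ideal_def
    by (rule ring.genideal_self[OF free_algebra_ring hecke_relations_carrier])
  with assms(1) have "word_mono u - word_mono v \<in> hecke_ideal I m" by (rule subsetD[rotated])
  then show ?thesis using hecke0_word_eq_iff[OF assms(2,3)] by blast
qed

lemma hecke_braid_monoid: "braid_monoid (hecke0 {1..n} matrix_A) n (T_gen {1..n} matrix_A)"
proof -
  let ?I = "{1..n}" and ?H = "hecke0 {1..n} matrix_A" and ?T = "T_gen {1..n} matrix_A"
  interpret ring ?H by (rule hecke0_ring)
  have br: "word_prod ?H ?T (alternating (matrix_A i j) i j) = word_prod ?H ?T (alternating (matrix_A i j) j i)"
    if "i \<in> ?I" "j \<in> ?I" for i j
    using that by (intro hecke_relations_word_eq alternating_lists) (auto simp: hecke_relations_def)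
  have idem: "word_prod ?H ?T [i, i] = word_prod ?H ?T [i]" if "i \<in> ?I" for i
    using that by (intro hecke_relations_word_eq) (auto simp: hecke_relations_def)
  have cl: "?T i \<in> carrier ?H" if "1 \<le> i" "i \<le> n" for i
    using T_gen_closed[of ?I matrix_A] that by auto
  show ?thesis
  proof (unfold_locales)
    fix i j assume "1 \<le> i" "Suc i < j" "j \<le> n"
    then show "?T i \<otimes>\<^bsub>?H\<^esub> ?T j = ?T j \<otimes>\<^bsub>?H\<^esub> ?T i"
      using br[of i j] cl[of i] cl[of j] by (simp add: matrix_A_def numeral_2_eq_2 del: One_nat_def)
  next
    fix i assume "1 \<le> i" "Suc i \<le> n"
    then show "?T i \<otimes>\<^bsub>?H\<^esub> (?T (Suc i) \<otimes>\<^bsub>?H\<^esub> ?T i) = ?T (Suc i) \<otimes>\<^bsub>?H\<^esub> (?T i \<otimes>\<^bsub>?H\<^esub> ?T (Suc i))"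
      using br[of i "Suc i"] cl[of i] cl[of "Suc i"] by (simp add: matrix_A_def numeral_3_eq_3 del: One_nat_def)
  next
    fix i assume "1 \<le> i" "i \<le> n"
    then show "?T i \<otimes>\<^bsub>?H\<^esub> ?T i \<in> {?T i, \<one>\<^bsub>?H\<^esub>}"
      using idem[of i] cl[of i] by (simp del: One_nat_def)
  qed (rule T_gen_closed)
qed

text \<open>The linear extension of the sorting representation, with values in the free abelian group on
  operators. Its kernel is a two-sided ideal containing the Hecke relations, so words that
  agree in the 0-Hecke algebra sort alike. This is the linear independence of the \<open>T\<^sub>w\<close> needed to
  recover \<open>w\<close> from \<open>T\<^sub>w\<close>.\<close>

definition sort_frag :: "(nat list \<Rightarrow>\<^sub>0 int) \<Rightarrow> (((nat \<Rightarrow> nat) \<Rightarrow> nat \<Rightarrow> nat) \<Rightarrow>\<^sub>0 int)" where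
  "sort_frag = frag_extend (\<lambda>u. frag_of (sorts u))"

lemma sort_frag_mult_left:
  "sort_frag p = 0 \<Longrightarrow> sort_frag (x * p) = 0"
proof -
  assume p: "sort_frag p = 0"
  have single: "sort_frag (word_mono v * q) = frag_extend (\<lambda>f. frag_of (sorts v \<circ> f)) (sort_frag q)" for v q
    using subset_UNIV
  proof (induction q rule: frag_induction)
    case (one u)
    then show ?case by (simp add: sort_frag_def mult_single plus_list_def foldr_append_comp comp_def)
  next
    case (diff a b)
    then show ?case by (simp add: sort_frag_def frag_extend_diff right_diff_distrib)
  qed (simp add: sort_frag_def)
  show ?thesis using subset_UNIV
  proof (induction x rule: frag_induction)
    case (one v)
    show ?case using p by (simp add: single)
  next
    case (diff a b)
    then show ?case by (simp add: sort_frag_def frag_extend_diff left_diff_distrib)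
  qed (simp add: sort_frag_def)
qed

lemma sort_frag_mult_right:
  "sort_frag p = 0 \<Longrightarrow> sort_frag (p * x) = 0"
proof -
  assume p: "sort_frag p = 0"
  have single: "sort_frag (q * word_mono v) = frag_extend (\<lambda>f. frag_of (f \<circ> sorts v)) (sort_frag q)" for v q
    using subset_UNIV
  proof (induction q rule: frag_induction)
    case (one u)
    then show ?case by (simp add: sort_frag_def mult_single plus_list_def foldr_append_comp comp_def)
  next
    case (diff a b)
    then show ?case by (simp add: sort_frag_def frag_extend_diff left_diff_distrib)
  qed (simp add: sort_frag_def)
  show ?thesis using subset_UNIV
  proof (induction x rule: frag_induction)
    case (one v)
    show ?case using p by (simp add: single)
  next
    case (diff a b)
    then show ?case by (simp add: sort_frag_def frag_extend_diff right_diff_distrib)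
  qed (simp add: sort_frag_def)
qed

lemma sort_frag_kernel_ideal:
  "ideal {p \<in> carrier (free_algebra I). sort_frag p = 0} (free_algebra I)"
proof (rule idealI)
  interpret ring "free_algebra I" by (rule free_algebra_ring)
  show "ring (free_algebra I)" by (rule free_algebra_ring)
  show "subgroup {p \<in> carrier (free_algebra I). sort_frag p = 0} (add_monoid (free_algebra I))"
  proof (rule add.subgroupI)
    fix p q assume "p \<in> {p \<in> carrier (free_algebra I). sort_frag p = 0}"
      "q \<in> {p \<in> carrier (free_algebra I). sort_frag p = 0}"
    then show "p \<oplus>\<^bsub>free_algebra I\<^esub> q \<in> {p \<in> carrier (free_algebra I). sort_frag p = 0}"
      using add.m_closed[of p q] by (auto simp: free_algebra_def sort_frag_def frag_extend_add)
  next
    fix p assume p: "p \<in> {p \<in> carrier (free_algebra I). sort_frag p = 0}"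
    then have "\<ominus>\<^bsub>free_algebra I\<^esub> p = - p"
      by (intro minus_equality) (auto simp: free_algebra_def)
    moreover have "\<ominus>\<^bsub>free_algebra I\<^esub> p \<in> carrier (free_algebra I)" using p by simp
    ultimately show "\<ominus>\<^bsub>free_algebra I\<^esub> p \<in> {p \<in> carrier (free_algebra I). sort_frag p = 0}"
      using p by (simp add: sort_frag_def frag_extend_minus)
  next
    have "0 \<in> {p \<in> carrier (free_algebra I). sort_frag p = 0}"
      by (simp add: free_algebra_def sort_frag_def)
    then show "{p \<in> carrier (free_algebra I). sort_frag p = 0} \<noteq> {}" by blast
  qed blast
next
  interpret ring "free_algebra I" by (rule free_algebra_ring)
  fix p x assume "p \<in> {p \<in> carrier (free_algebra I). sort_frag p = 0}" "x \<in> carrier (free_algebra I)"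
  then show "x \<otimes>\<^bsub>free_algebra I\<^esub> p \<in> {p \<in> carrier (free_algebra I). sort_frag p = 0}"
    and "p \<otimes>\<^bsub>free_algebra I\<^esub> x \<in> {p \<in> carrier (free_algebra I). sort_frag p = 0}"
    using m_closed[of x p] m_closed[of p x]
    by (auto simp: free_algebra_def sort_frag_mult_left sort_frag_mult_right)
qed

lemma sorts_alternating:
  "sorts (alternating (matrix_A i j) i j) = sorts (alternating (matrix_A i j) j i)"
proof (cases "i < j")
  case True
  then show ?thesis
    using sort_at_commute[of i j] sort_at_braid[of i]
    by (auto simp: matrix_A_def fun_eq_iff numeral_2_eq_2 numeral_3_eq_3)
next
  case False
  then show ?thesis
    using sort_at_commute[of j i] sort_at_braid[of j]
    by (auto simp: matrix_A_def fun_eq_iff numeral_2_eq_2 numeral_3_eq_3)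
qed

lemma hecke0_word_eq_imp_sorts:
  assumes "u \<in> lists I" "v \<in> lists I"
    and "word_prod (hecke0 I matrix_A) (T_gen I matrix_A) u = word_prod (hecke0 I matrix_A) (T_gen I matrix_A) v"
  shows "sorts u = sorts v"
proof -
  have "sort_frag p = 0" if p: "p \<in> hecke_relations I matrix_A" for p
  proof -
    consider i where "p = word_mono [i, i] - word_mono [i]"
      | i j where "p = word_mono (alternating (matrix_A i j) i j) - word_mono (alternating (matrix_A i j) j i)"
      using p unfolding hecke_relations_def by blast
    then show ?thesis
    proof cases
      case (1 i)
      have "sorts [i, i] = sorts [i]" by (simp add: fun_eq_iff)
      then show ?thesis unfolding 1 sort_frag_def frag_extend_diff frag_extend_of by simp
    next
      case (2 i j)
      show ?thesis
        unfolding 2 sort_frag_def frag_extend_diff frag_extend_of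
        by (simp add: sorts_alternating[of i j])
    qed
  qed
  then have "hecke_ideal I matrix_A \<subseteq> {p \<in> carrier (free_algebra I). sort_frag p = 0}"
    unfolding hecke_ideal_def using hecke_relations_carrier
    by (intro ring.genideal_minimal[OF free_algebra_ring] sort_frag_kernel_ideal) blast
  then have "sort_frag (word_mono u - word_mono v) = 0"
    using assms hecke0_word_eq_iff by blast
  then have "frag_of (sorts u) = frag_of (sorts v)"
    by (simp add: sort_frag_def frag_extend_diff)
  then show ?thesis by (simp only: frag_of_eq)
qed

text \<open>Conversely, words that sort the identity alike have the same normal form. Applied to reduced words
  of one element this gives Matsumoto's theorem in the 0-Hecke algebra, hence that \<open>T\<^sub>w\<close> is well defined.\<close>

lemma hecke0_word_eq_iff_sort:
  assumes u: "u \<in> lists {1..n}" and v: "v \<in> lists {1..n}"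
  shows "word_prod (hecke0 {1..n} matrix_A) (T_gen {1..n} matrix_A) u =
      word_prod (hecke0 {1..n} matrix_A) (T_gen {1..n} matrix_A) v \<longleftrightarrow> word_sort u = word_sort v"
proof
  let ?wp = "word_prod (hecke0 {1..n} matrix_A) (T_gen {1..n} matrix_A)"
  interpret braid_monoid "hecke0 {1..n} matrix_A" n "T_gen {1..n} matrix_A"
    by (rule hecke_braid_monoid)
  show "word_sort u = word_sort v" if "?wp u = ?wp v"
    unfolding word_sort_def by (rule fun_cong[OF hecke0_word_eq_imp_sorts[OF u v that]])
  assume eq: "word_sort u = word_sort v"
  obtain x y where xy: "x \<in> normal_words n" "?wp u = ?wp x" "y \<in> normal_words n" "?wp v = ?wp y"
    using normal_form[OF u] normal_form[OF v] by blast
  have "word_sort u = word_sort x" "word_sort v = word_sort y"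
    unfolding word_sort_def
    by (rule fun_cong[OF hecke0_word_eq_imp_sorts[OF u normal_words_lists[OF xy(1)] xy(2)]]
        fun_cong[OF hecke0_word_eq_imp_sorts[OF v normal_words_lists[OF xy(3)] xy(4)]])+
  then have "x = y" using eq by (intro normal_words_sort_unique[OF xy(1,3)]) (simp only:)
  then show "?wp u = ?wp v" by (simp only: xy(2,4))
qed

section \<open>Coxeter systems of type A\<close>

lemma swaps_coxeter_relation: "swaps (concat (replicate (matrix_A i j) [i, j])) = swaps []"
proof -
  consider "i = j" | "j = Suc i" | "i = Suc j" | "Suc i < j" | "Suc j < i" by linarith
  then show ?thesis
  proof cases
    case 1
    then show ?thesis by (simp add: matrix_A_def fun_eq_iff)
  next
    case 2
    then show ?thesis by (simp add: matrix_A_def numeral_3_eq_3 swap_at_braid fun_eq_iff)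
  next
    case 3
    then show ?thesis by (simp add: matrix_A_def numeral_3_eq_3 swap_at_braid[symmetric] fun_eq_iff)
  next
    case 4
    then have "swap_at i (swap_at j (swap_at i (swap_at j p))) = p" for p
      by (subst swap_at_commute) simp_all
    with 4 show ?thesis by (simp add: matrix_A_def numeral_2_eq_2 fun_eq_iff)
  next
    case 5
    then have "swap_at i (swap_at j (swap_at i (swap_at j p))) = p" for p
      by (subst swap_at_commute[symmetric]) simp_all
    with 5 show ?thesis by (simp add: matrix_A_def numeral_2_eq_2 fun_eq_iff)
  qed
qed

lemma swaps_coxeter_cong: "coxeter_cong I matrix_A u v \<Longrightarrow> swaps u = swaps v"
proof (induction rule: coxeter_cong.induct)
  case (rel i j)
  show ?case by (rule swaps_coxeter_relation)
next
  case (ctxt u v x y)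
  then show ?case by (simp only: foldr_append_comp)
qed simp_all

lemma word_perm_stabilises:
  assumes "u \<in> lists J" "k \<notin> J"
  shows "word_perm u i \<le> k \<longleftrightarrow> i \<le> k"
  using assms(1)
proof (induction u arbitrary: i rule: list.induct)
  case (Cons j u)
  then have "j \<noteq> k" "u \<in> lists J" using assms(2) by auto
  then have "word_perm (j # u) i \<le> k \<longleftrightarrow> (if i = Suc j then j \<le> k else if i = j then Suc j \<le> k else i \<le> k)"
    using Cons.IH by (simp only: word_perm_simps swap_at_def fun_upd_apply split: if_split) simp
  then show ?case using \<open>j \<noteq> k\<close> by auto
qed simp

locale coxeter_A =
  fixes W :: "('w, 'x) monoid_scheme" (structure) and n :: nat and s :: "nat \<Rightarrow> 'w"
  assumes system: "coxeter_system W {1..n} matrix_A s"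
begin

sublocale group W
  using system by (simp add: coxeter_system_def)

abbreviation wp :: "nat list \<Rightarrow> 'w" where "wp \<equiv> word_prod W s"
abbreviation wpH :: "nat list \<Rightarrow> (nat list \<Rightarrow>\<^sub>0 int) set" where
  "wpH \<equiv> word_prod (hecke0 {1..n} matrix_A) (T_gen {1..n} matrix_A)"

lemma s_funcset: "s \<in> {1..n} \<rightarrow> carrier W"
  using system by (simp add: coxeter_system_def)

lemma wp_eq_iff_cong:
  "\<lbrakk>u \<in> lists {1..n}; v \<in> lists {1..n}\<rbrakk> \<Longrightarrow> wp u = wp v \<longleftrightarrow> coxeter_cong {1..n} matrix_A u v"
  using system by (simp add: coxeter_system_def)

lemma wp_relation:
  assumes "i \<in> {1..n}" "j \<in> {1..n}"
  shows "wp (concat (replicate (matrix_A i j) [i, j])) = \<one>"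
proof -
  have "concat (replicate k [i, j]) \<in> lists {1..n}" for k
    using assms by (induction k) auto
  then show ?thesis
    using wp_eq_iff_cong[of _ "[]"] coxeter_cong.rel[OF assms, of matrix_A] by simp
qed

sublocale braid_monoid W n s
proof (unfold_locales)
  have closed: "s i \<in> carrier W" if "1 \<le> i" "i \<le> n" for i
    using s_funcset that by auto
  have sq: "s i \<otimes> s i = \<one>" if "1 \<le> i" "i \<le> n" for i
    using wp_relation[of i i] closed[OF that] that by (simp add: matrix_A_def)
  have cancel: "s i \<otimes> (s i \<otimes> z) = z" if "1 \<le> i" "i \<le> n" "z \<in> carrier W" for i z
    using sq[of i] closed[of i] that by (simp add: m_assoc[symmetric])
  show "s \<in> {1..n} \<rightarrow> carrier W" by (rule s_funcset)
  fix i :: nat assume i: "1 \<le> i"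
  {
    fix j :: nat assume j: "Suc i < j" "j \<le> n"
    have c: "s i \<in> carrier W" "s j \<in> carrier W" using closed i j by auto
    have "s i \<otimes> (s j \<otimes> (s i \<otimes> s j)) = \<one>"
      using wp_relation[of i j] c i j by (simp add: matrix_A_def numeral_2_eq_2)
    then have "s j \<otimes> s i = s j \<otimes> (s i \<otimes> (s i \<otimes> (s j \<otimes> (s i \<otimes> s j))))"
      using c by simp
    also have "\<dots> = s i \<otimes> s j" using cancel c i j by simp
    finally show "s i \<otimes> s j = s j \<otimes> s i" ..
  next
    assume j: "Suc i \<le> n"
    let ?x = "s i" and ?y = "s (Suc i)"
    have c: "?x \<in> carrier W" "?y \<in> carrier W" using closed i j by auto
    have "?x \<otimes> (?y \<otimes> (?x \<otimes> (?y \<otimes> (?x \<otimes> ?y)))) = \<one>"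
      using wp_relation[of i "Suc i"] c i j by (simp add: matrix_A_def numeral_3_eq_3)
    then have "?x \<otimes> (?x \<otimes> (?y \<otimes> (?x \<otimes> (?y \<otimes> (?x \<otimes> ?y))))) = ?x"
      using c by simp
    then have "?y \<otimes> (?x \<otimes> (?y \<otimes> (?x \<otimes> ?y))) = ?x"
      using cancel i j c by simp
    then have "?y \<otimes> (?y \<otimes> (?x \<otimes> (?y \<otimes> (?x \<otimes> ?y)))) \<otimes> ?y = ?y \<otimes> ?x \<otimes> ?y"
      by simp
    moreover have "?y \<otimes> (?y \<otimes> (?x \<otimes> (?y \<otimes> (?x \<otimes> ?y)))) \<otimes> ?y = ?x \<otimes> (?y \<otimes> ?x)"
      using cancel[of "Suc i"] sq[of "Suc i"] i j c by (simp add: m_assoc)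
    ultimately show "?x \<otimes> (?y \<otimes> ?x) = ?y \<otimes> (?x \<otimes> ?y)"
      using c by (simp add: m_assoc)
  next
    assume "i \<le> n"
    then show "s i \<otimes> s i \<in> {s i, \<one>}" using sq i by simp
  }
qed

text \<open>The group with the type A presentation is the symmetric group: the relations hold for adjacent
  swaps, and both words reduce to normal words, which their permutations distinguish.\<close>

lemma wp_eq_iff:
  assumes u: "u \<in> lists {1..n}" and v: "v \<in> lists {1..n}"
  shows "wp u = wp v \<longleftrightarrow> word_perm u = word_perm v"
proof
  have sound: "word_perm x = word_perm y" if "x \<in> lists {1..n}" "y \<in> lists {1..n}" "wp x = wp y" for x y
  proof -
    have "swaps x = swaps y" using wp_eq_iff_cong[OF that(1,2)] that(3) swaps_coxeter_cong by blast
    then show ?thesis by (simp only: word_perm_def)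
  qed
  then show "word_perm u = word_perm v" if "wp u = wp v" using u v that by blast
  assume eq: "word_perm u = word_perm v"
  obtain x y where xy: "x \<in> normal_words n" "wp u = wp x" "y \<in> normal_words n" "wp v = wp y"
    using normal_form[OF u] normal_form[OF v] by blast
  have "word_perm x = word_perm y"
    using eq sound[OF u normal_words_lists[OF xy(1)] xy(2)] sound[OF v normal_words_lists[OF xy(3)] xy(4)]
    by simp
  then have "x = y" by (rule normal_word_unique[OF xy(1,3)])
  then show "wp u = wp v" by (simp only: xy(2,4))
qed

lemma reduced_representative:
  assumes u: "u \<in> lists {1..n}"
  obtains v where "v \<in> lists {1..n}" "wp v = wp u" "word_perm v = word_perm u" "increasing v"
proof -
  obtain v where v: "v \<in> normal_words n" "wp u = wp v" using normal_form[OF u] by blast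
  then show ?thesis
    using that[of v] normal_words_lists normal_word_increasing wp_eq_iff[OF u, of v] by simp
qed

lemma cox_length_word:
  assumes u: "u \<in> lists {1..n}"
  shows "cox_length W {1..n} s (wp u) = card (inversions (Suc n) (word_perm u))"
  unfolding cox_length_def
proof (rule Least_equality)
  obtain v where v: "v \<in> lists {1..n}" "wp v = wp u" "word_perm v = word_perm u" "increasing v"
    by (rule reduced_representative[OF u])
  then have "length v = card (inversions (Suc n) (word_perm u))"
    using card_inversions_word[OF v(1)] by simp
  then show "\<exists>v\<in>lists {1..n}. length v = card (inversions (Suc n) (word_perm u)) \<and> wp v = wp u"
    using v by blast
next
  fix k assume "\<exists>v\<in>lists {1..n}. length v = k \<and> wp v = wp u"
  then obtain v where v: "v \<in> lists {1..n}" "length v = k" "wp v = wp u" by blast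
  then have "word_perm v = word_perm u" using wp_eq_iff[OF v(1) u] by simp
  then show "card (inversions (Suc n) (word_perm u)) \<le> k"
    using card_inversions_word[OF v(1)] v(2) by simp
qed

lemma reduced_word_iff:
  assumes u: "u \<in> lists {1..n}"
  shows "reduced_word W {1..n} s (wp u) v \<longleftrightarrow> v \<in> lists {1..n} \<and> wp v = wp u \<and> increasing v"
proof -
  have "length v = cox_length W {1..n} s (wp u) \<longleftrightarrow> increasing v"
    if "v \<in> lists {1..n}" "wp v = wp u"
  proof -
    have "word_perm v = word_perm u" using wp_eq_iff[OF that(1) u] that(2) by simp
    then show ?thesis
      unfolding cox_length_word[OF u] using card_inversions_word[OF that(1)] by auto
  qed
  then show ?thesis by (auto simp: reduced_word_def)
qed

text \<open>All reduced words of an element sort to its permutation, so they have the same image and the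
  description in the definition of \<open>T_elem\<close> is meaningful.\<close>

lemma T_elem_word:
  assumes v: "v \<in> lists {1..n}" and inc: "increasing v"
  shows "T_elem W {1..n} matrix_A s (wp v) = wpH v"
  unfolding T_elem_def
proof (rule the_equality)
  show "\<forall>u. reduced_word W {1..n} s (wp v) u \<longrightarrow> wpH u = wpH v"
  proof (intro allI impI)
    fix u assume "reduced_word W {1..n} s (wp v) u"
    then have u: "u \<in> lists {1..n}" "wp u = wp v" "increasing u"
      unfolding reduced_word_iff[OF v] by simp_all
    then have "word_perm u = word_perm v" using wp_eq_iff[OF u(1) v] by simp
    then show "wpH u = wpH v"
      unfolding hecke0_word_eq_iff_sort[OF u(1) v] increasing_sort[OF u(3)] increasing_sort[OF inc] .
  qed
next
  fix t assume "\<forall>u. reduced_word W {1..n} s (wp v) u \<longrightarrow> wpH u = t"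
  moreover have "reduced_word W {1..n} s (wp v) v"
    unfolding reduced_word_iff[OF v] using v inc by simp
  ultimately show "t = wpH v" by blast
qed

lemma parabolic_words:
  assumes "J \<subseteq> {1..n}"
  shows "parabolic W s J = wp ` lists J"
proof (intro equalityI subsetI)
  have app: "wp (u @ v) = wp u \<otimes> wp v" if "u \<in> lists J" "v \<in> lists J" for u v
    using prod_append[of u v] that assms lists_mono[OF assms] by blast
  fix x assume "x \<in> parabolic W s J"
  then have "x \<in> generate W (s ` J)" by (simp add: parabolic_def)
  then show "x \<in> wp ` lists J"
  proof (induction rule: generate.induct)
    case one
    have "\<one> = wp []" "[] \<in> lists J" by simp_all
    then show ?case by (rule image_eqI)
  next
    case (incl h)
    then obtain i where i: "i \<in> J" "h = s i" by blast
    then have "h = wp [i]" using gen_closed[of i] assms by auto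
    then show ?case using i by (intro image_eqI[of _ _ "[i]"]) auto
  next
    case (inv h)
    then obtain i where i: "i \<in> J" "h = s i" by blast
    then have si: "s i \<in> carrier W" "1 \<le> i" "i \<le> n" using gen_closed[of i] assms by auto
    have "s i \<otimes> s i = \<one>" using wp_relation[of i i] si by (simp add: matrix_A_def)
    then have "inv h = wp [i]" using i si by (simp add: inv_equality)
    then show ?case using i by (intro image_eqI[of _ _ "[i]"]) auto
  next
    case (eng x y)
    then obtain u v where "u \<in> lists J" "v \<in> lists J" "x = wp u" "y = wp v" by blast
    then show ?case using app by (intro image_eqI[of _ _ "u @ v"]) auto
  qed
next
  fix x assume "x \<in> wp ` lists J"
  then obtain u where "u \<in> lists J" "x = wp u" by blast
  moreover have "wp u \<in> generate W (s ` J)" using \<open>u \<in> lists J\<close>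
  proof (induction u rule: list.induct)
    case (Cons i u)
    then have "s i \<in> generate W (s ` J)" "wp u \<in> generate W (s ` J)" by (auto intro: generate.incl)
    then show ?case by (simp add: generate.eng)
  qed (simp add: generate.one)
  ultimately show "x \<in> parabolic W s J" by (simp add: parabolic_def)
qed

lemma carrier_words: "carrier W = wp ` lists {1..n}"
proof -
  have "carrier W = parabolic W s {1..n}"
    using system unfolding coxeter_system_def parabolic_def by blast
  then show ?thesis unfolding parabolic_words[OF order.refl] .
qed

text \<open>An element of maximal length has all generators in \<open>J\<close> as descents, and every element of the
  parabolic subgroup preserves the blocks. So its permutation reverses \<open>J\<close>, which leaves only one
  candidate; existence holds because the number of inversions is bounded.\<close>

lemma longest_word:
  assumes J: "J \<subseteq> {1..n}"
  shows "\<exists>u\<in>lists J. longest W {1..n} s J = wp u \<and> reverses n J (word_perm u)"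
proof -
  let ?len = "cox_length W {1..n} s"
  have lists: "u \<in> lists {1..n}" if "u \<in> lists J" for u
    by (rule subsetD[OF lists_mono[OF J] that])
  define maximal where "maximal = (\<lambda>w. w \<in> parabolic W s J \<and> (\<forall>v\<in>parabolic W s J. ?len v \<le> ?len w))"
  have rev: "reverses n J (word_perm u)" if "u \<in> lists J" "maximal (wp u)" for u
    unfolding reverses_def
  proof (intro conjI allI ballI impI)
    show perm: "word_perm u permutes {1..Suc n}" by (rule word_perm_permutes[OF lists[OF that(1)]])
    fix i assume i: "i \<in> J"
    then have iu: "i # u \<in> lists J" using that(1) by simp
    have "wp (i # u) \<in> parabolic W s J" unfolding parabolic_words[OF J] using iu by (rule imageI)
    then have "?len (wp (i # u)) \<le> ?len (wp u)" using that(2) unfolding maximal_def by blast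
    then have "card (inversions (Suc n) (swap_at i (word_perm u))) \<le> card (inversions (Suc n) (word_perm u))"
      unfolding cox_length_word[OF lists[OF iu]] cox_length_word[OF lists[OF that(1)]] by simp
    moreover have "1 \<le> i" "i < Suc n" using i J by auto
    ultimately have "\<not> word_perm u i < word_perm u (Suc i)"
      using card_inversions_ascent[of i "Suc n" "word_perm u"] by auto
    moreover have "word_perm u i \<noteq> word_perm u (Suc i)"
      using permutes_inj[OF perm] by (auto dest: injD)
    ultimately show "word_perm u (Suc i) < word_perm u i" by simp
  next
    fix k i assume "k \<notin> J"
    with that(1) show "word_perm u i \<le> k \<longleftrightarrow> i \<le> k" by (rule word_perm_stabilises)
  qed
  have "\<exists>w. w \<in> parabolic W s J \<and> (\<forall>v. v \<in> parabolic W s J \<longrightarrow> ?len v \<le> ?len w)"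
  proof (rule ex_has_greatest_nat[of "\<lambda>w. w \<in> parabolic W s J" "wp []" ?len
        "Suc (card ({1..Suc n} \<times> {1..Suc n}))"])
    show "wp [] \<in> parabolic W s J" unfolding parabolic_words[OF J] by (rule imageI) simp
    show "\<forall>v. v \<in> parabolic W s J \<longrightarrow> ?len v < Suc (card ({1..Suc n} \<times> {1..Suc n}))"
    proof (intro allI impI)
      fix v assume "v \<in> parabolic W s J"
      then obtain u where u: "u \<in> lists J" "v = wp u" unfolding parabolic_words[OF J] by blast
      show "?len v < Suc (card ({1..Suc n} \<times> {1..Suc n}))"
        unfolding u(2) cox_length_word[OF lists[OF u(1)]]
        by (intro le_imp_less_Suc card_mono) (auto simp: inversions_def)
    qed
  qed
  then obtain w where w: "maximal w" unfolding maximal_def by blast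
  have word: "\<exists>u\<in>lists J. v = wp u" if "maximal v" for v
  proof -
    have "v \<in> parabolic W s J" using that by (simp add: maximal_def)
    then show ?thesis unfolding parabolic_words[OF J] by blast
  qed
  have uniq: "v = w" if v: "maximal v" for v
  proof -
    obtain x where x: "x \<in> lists J" "v = wp x" using word[OF v] by blast
    obtain y where y: "y \<in> lists J" "w = wp y" using word[OF w] by blast
    note xy = x(1) y(1) x(2) y(2)
    then have "word_perm x = word_perm y"
      using v w by (intro reverses_unique[of n J] rev) simp_all
    then show ?thesis unfolding xy(3,4) wp_eq_iff[OF lists[OF xy(1)] lists[OF xy(2)]] .
  qed
  have "longest W {1..n} s J = w"
    unfolding longest_def maximal_def[symmetric] using w uniq by (rule the_equality)
  moreover obtain u where u: "u \<in> lists J" "w = wp u" using word[OF w] by blast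
  moreover have "reverses n J (word_perm u)" using rev[OF u(1)] w u(2) by simp
  ultimately show ?thesis by (intro bexI[of _ u]) simp_all
qed

lemma longest_inj:
  assumes "J \<subseteq> {1..n}" "K \<subseteq> {1..n}" "longest W {1..n} s J = longest W {1..n} s K"
  shows "J = K"
proof -
  obtain u where u: "u \<in> lists J" "longest W {1..n} s J = wp u" "reverses n J (word_perm u)"
    using longest_word[OF assms(1)] by blast
  obtain v where v: "v \<in> lists K" "longest W {1..n} s K = wp v" "reverses n K (word_perm v)"
    using longest_word[OF assms(2)] by blast
  have lists: "u \<in> lists {1..n}" "v \<in> lists {1..n}"
    by (rule subsetD[OF lists_mono[OF assms(1)] u(1)] subsetD[OF lists_mono[OF assms(2)] v(1)])+
  have "wp u = wp v" using u(2) v(2) assms(3) by simp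
  then have "word_perm u = word_perm v" using wp_eq_iff[OF lists] by simp
  then show ?thesis using u(3) v(3) by (intro reverses_support_unique[of n J "word_perm u" K]) simp_all
qed

text \<open>The star product is computed by letting a word for the first factor sort the permutation of the
  second. The word \<open>r\<close> need not be reduced: it only has to sort the identity to the permutation
  of the first factor, for then \<open>r\<close> and a reduced word are equal in the 0-Hecke algebra and act
  alike on every sequence.\<close>

lemma demazure_word:
  assumes u: "u \<in> lists {1..n}" and v: "v \<in> lists {1..n}" and w: "w \<in> lists {1..n}"
    and r: "r \<in> lists {1..n}"
    and ru: "word_sort r = word_perm u" and rv: "sorts r (word_perm v) = word_perm w"
  shows "demazure W {1..n} matrix_A s (wp u) (wp v) = wp w"
proof -
  interpret H: braid_monoid "hecke0 {1..n} matrix_A" n "T_gen {1..n} matrix_A"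
    by (rule hecke_braid_monoid)
  let ?T = "T_elem W {1..n} matrix_A s"
  obtain x where x: "x \<in> lists {1..n}" "wp x = wp u" "word_perm x = word_perm u" "increasing x"
    by (rule reduced_representative[OF u])
  obtain y where y: "y \<in> lists {1..n}" "wp y = wp v" "word_perm y = word_perm v" "increasing y"
    by (rule reduced_representative[OF v])
  have T: "?T (wp u) = wpH x" "?T (wp v) = wpH y"
    using T_elem_word[OF x(1,4)] T_elem_word[OF y(1,4)] x(2) y(2) by simp_all
  have "word_sort x = word_sort r" using x ru by (simp add: increasing_sort)
  then have "wpH x = wpH r" using hecke0_word_eq_iff_sort[OF x(1) r] by blast
  then have "sorts x = sorts r" by (rule hecke0_word_eq_imp_sorts[OF x(1) r])
  then have "word_sort (x @ y) = sorts r (word_sort y)"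
    by (simp only: word_sort_def foldr_append o_apply)
  also have "\<dots> = word_perm w" using y rv by (simp add: increasing_sort)
  finally have xy: "word_sort (x @ y) = word_perm w" .
  have eq: "?T (wp u) \<otimes>\<^bsub>hecke0 {1..n} matrix_A\<^esub> ?T (wp v) = ?T (wp z) \<longleftrightarrow> wp z = wp w"
    if z: "z \<in> lists {1..n}" for z
  proof -
    obtain z' where z': "z' \<in> lists {1..n}" "wp z' = wp z" "word_perm z' = word_perm z" "increasing z'"
      by (rule reduced_representative[OF z])
    have Tz: "?T (wp z) = wpH z'" using T_elem_word[OF z'(1,4)] z'(2) by simp
    have "x @ y \<in> lists {1..n}" using x(1) y(1) by simp
    note iff = hecke0_word_eq_iff_sort[OF this z'(1)]
    show ?thesis
      unfolding T Tz H.prod_append[OF x(1) y(1), symmetric] iff xy increasing_sort[OF z'(4)] z'(3)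
        wp_eq_iff[OF z w] by (rule eq_commute)
  qed
  show ?thesis unfolding demazure_def
  proof (rule the_equality)
    show "wp w \<in> carrier W \<and> ?T (wp u) \<otimes>\<^bsub>hecke0 {1..n} matrix_A\<^esub> ?T (wp v) = ?T (wp w)"
      using eq[OF w] prod_closed[OF w] by simp
    fix z assume "z \<in> carrier W \<and> ?T (wp u) \<otimes>\<^bsub>hecke0 {1..n} matrix_A\<^esub> ?T (wp v) = ?T z"
    then show "z = wp w" unfolding carrier_words using eq by blast
  qed
qed

lemma coset_word:
  assumes "1 \<le> a" "c \<le> n"
  obtains u where "u \<in> lists {1..n}"
    "longest W {1..n} s {a..c} \<otimes> longest W {1..n} s {1..n} = wp u" "word_perm u = coset_perm n a c"
proof -
  have J: "{a..c} \<subseteq> {1..n}" using assms by auto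
  obtain x where x: "x \<in> lists {a..c}" "longest W {1..n} s {a..c} = wp x" "reverses n {a..c} (word_perm x)"
    using longest_word[OF J] by blast
  obtain y where y: "y \<in> lists {1..n}" "longest W {1..n} s {1..n} = wp y" "reverses n {1..n} (word_perm y)"
    using longest_word[OF order.refl] by blast
  have xl: "x \<in> lists {1..n}" by (rule subsetD[OF lists_mono[OF J] x(1)])
  have "word_perm x = block_rev a (Suc c)" "word_perm y = block_rev 1 (Suc n)"
    using reverses_unique[OF x(3) reverses_block_rev] reverses_unique[OF y(3) reverses_block_rev] assms
    by simp_all
  then have "word_perm (x @ y) = coset_perm n a c"
    unfolding word_perm_append swaps_comp[of x] coset_perm_def by simp
  then show ?thesis using that[of "x @ y"] xl x(2) y(1,2) prod_append[OF xl y(1)] by simp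
qed

text \<open>The word for the first factor performs \<open>a - 1\<close> and \<open>b\<close> bubble passes, which shrink the interval of
  the second factor by \<open>a - 1\<close> on the left and by \<open>b\<close> on the right. Uniqueness of the resulting subset
  follows by cancelling \<open>w\<^sub>0\<^sup>I\<close>, since a parabolic subgroup is recovered from its longest element.\<close>

lemma cox_star_intervals:
  assumes a: "1 \<le> a" "1 \<le> a'"
  shows "cox_star W {1..n} matrix_A s {a..n - b} {a'..n - b'} = {a + a' - 1..n - b - b'}"
  unfolding cox_star_def
proof (rule the_equality)
  let ?l = "longest W {1..n} s" and ?K = "{a + a' - 1..n - b - b'}"
  let ?D = "demazure W {1..n} matrix_A s (?l {a..n - b} \<otimes> ?l {1..n}) (?l {a'..n - b'} \<otimes> ?l {1..n})"
  obtain u where u: "u \<in> lists {1..n}" "?l {a..n - b} \<otimes> ?l {1..n} = wp u" "word_perm u = coset_perm n a (n - b)"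
    by (rule coset_word[of a "n - b"]) (use a in auto)
  obtain v where v: "v \<in> lists {1..n}" "?l {a'..n - b'} \<otimes> ?l {1..n} = wp v" "word_perm v = coset_perm n a' (n - b')"
    by (rule coset_word[of a' "n - b'"]) (use a in auto)
  obtain w where w: "w \<in> lists {1..n}" "?l ?K \<otimes> ?l {1..n} = wp w"
      "word_perm w = coset_perm n (a + a' - 1) (n - b - b')"
    by (rule coset_word[of "a + a' - 1" "n - b - b'"]) (use a in auto)
  let ?r = "shift_word n (a - 1) b"
  have "word_sort ?r = sorts ?r (coset_perm n 1 n)"
    unfolding word_sort_def coset_perm_id ..
  also have "\<dots> = word_perm u"
    unfolding u(3) using a by (subst sorts_shift_word) auto
  finally have "word_sort ?r = word_perm u" .
  moreover have "sorts ?r (word_perm v) = word_perm w"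
  proof -
    have "a' + (a - 1) = a + a' - 1" "n - b' - b = n - b - b'" using a by auto
    then show ?thesis unfolding v(3) w(3) using sorts_shift_word[of a' "n - b'" n "a - 1" b] a by simp
  qed
  ultimately have D: "?D = ?l ?K \<otimes> ?l {1..n}"
    unfolding u(2) v(2) w(2) by (rule demazure_word[OF u(1) v(1) w(1) shift_word_lists])
  have K: "?K \<subseteq> {1..n}" using a by auto
  show "?K \<subseteq> {1..n} \<and> ?D = ?l ?K \<otimes> ?l {1..n}" using K D by blast
  have closed: "?l J \<in> carrier W" if J: "J \<subseteq> {1..n}" for J
  proof -
    obtain x where "x \<in> lists J" "?l J = wp x" using longest_word[OF J] by blast
    moreover have "x \<in> lists {1..n}" by (rule subsetD[OF lists_mono[OF J] \<open>x \<in> lists J\<close>])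
    ultimately show ?thesis using prod_closed by simp
  qed
  fix L assume L: "L \<subseteq> {1..n} \<and> ?D = ?l L \<otimes> ?l {1..n}"
  then have "?l L \<otimes> ?l {1..n} = ?l ?K \<otimes> ?l {1..n}" using D by simp
  then have "?l L = ?l ?K" using closed L K by simp
  then show "L = ?K" using longest_inj L K by blast
qed

end

theorem mainTheorem2:
  fixes W :: "('w, 'x) monoid_scheme" and s :: "nat \<Rightarrow> 'w"
    and n a b a' b' :: nat and J1 J2 :: "nat set"
  assumes "coxeter_system W {1..n} matrix_A s"
    and "1 \<le> a" and "1 \<le> a'"
    and "J1 = {a..n - b}" and "J2 = {a'..n - b'}"
    and "J1 \<noteq> {}" and "J1 \<subset> {1..n}" and "cox_connected matrix_A J1"
    and "J2 \<noteq> {}" and "J2 \<subset> {1..n}" and "cox_connected matrix_A J2"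
  shows "cox_star W {1..n} matrix_A s J1 J2 = {a + a' - 1..n - b - b'}"
proof -
  interpret coxeter_A W n s by (unfold_locales) (rule assms(1))
  show ?thesis unfolding assms(4,5) by (rule cox_star_intervals[OF assms(2,3)])
qed

end
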